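(* Let $k$ be a field and let $I\subseteq k[x_0,\ldots,x_n]$ be a homogeneous ideal of dimension $d$, with $d\ge0$. Then \[h_I(m)\ge\binom{m+d+1}{d+1}-\binom{m-\deg I+d+1}{d+1}\qquad\text{for all } m\ge1.\]
   Context: The dimension of a homogeneous ideal $I\subseteq k[x_0,\ldots,x_n]$ is the dimension of the projective variety it defines in $\mathbb P^n(\bar k)$ (Krull dimension minus one). The Hilbert function is $h_I(m):=\dim_k(k[x_0,\ldots,x_n]/I)_m$. If $I$ has dimension $d\ge0$ and Hilbert polynomial $p_I(t)=a_dt^d+\cdots+a_0$ (so $h_I(m)=p_I(m)$ for $m\gg0$), then $\deg I:=d!\,a_d$. Binomial coefficients $\binom{a}{b}$ with integer $a<b$ are taken to be $0$. *)

theory Defs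
  imports "HOL-Library.Poly_Mapping" "HOL-Library.Extended_Nat"
          "HOL-Computational_Algebra.Polynomial"
begin

text \<open>Polynomial ring k[x_v : v in 'v] over a field 'k, with a finite type 'v of
  variables (|'v| = n+1).  Monomials are exponent vectors 'v =>0 nat.\<close>

type_synonym ('v, 'k) mpoly = "('v \<Rightarrow>\<^sub>0 nat) \<Rightarrow>\<^sub>0 'k"

definition mon_deg :: "('v::finite \<Rightarrow>\<^sub>0 nat) \<Rightarrow> nat" where
  "mon_deg \<alpha> = (\<Sum>v\<in>UNIV. Poly_Mapping.lookup \<alpha> v)"

definition hom_comp :: "nat \<Rightarrow> ('v::finite, 'k::zero) mpoly \<Rightarrow> ('v, 'k) mpoly" where
  "hom_comp j f = Abs_poly_mapping (\<lambda>\<alpha>. if mon_deg \<alpha> = j then Poly_Mapping.lookup f \<alpha> else 0)"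

definition hom_part :: "nat \<Rightarrow> ('v::finite, 'k::zero) mpoly set" where
  "hom_part m = {f. \<forall>\<alpha>\<in>Poly_Mapping.keys f. mon_deg \<alpha> = m}"

definition is_ideal :: "('v::finite, 'k::field) mpoly set \<Rightarrow> bool" where
  "is_ideal I \<longleftrightarrow> 0 \<in> I \<and> (\<forall>a\<in>I. \<forall>b\<in>I. a + b \<in> I) \<and> (\<forall>r. \<forall>a\<in>I. r * a \<in> I)"

definition is_prime_ideal :: "('v::finite, 'k::field) mpoly set \<Rightarrow> bool" where
  "is_prime_ideal P \<longleftrightarrow> is_ideal P \<and> P \<noteq> UNIV \<and> (\<forall>a b. a * b \<in> P \<longrightarrow> a \<in> P \<or> b \<in> P)"

definition is_homogeneous_ideal :: "('v::finite, 'k::field) mpoly set \<Rightarrow> bool" where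
  "is_homogeneous_ideal I \<longleftrightarrow> is_ideal I \<and> (\<forall>f\<in>I. \<forall>j. hom_comp j f \<in> I)"

definition krull_dim_quot :: "('v::finite, 'k::field) mpoly set \<Rightarrow> enat" where
  "krull_dim_quot I = Sup {enat r | r. \<exists>P :: nat \<Rightarrow> ('v, 'k) mpoly set.
       (\<forall>i\<le>r. is_prime_ideal (P i) \<and> I \<subseteq> P i) \<and> (\<forall>i<r. P i \<subset> P (Suc i))}"

definition proj_dim :: "('v::finite, 'k::field) mpoly set \<Rightarrow> int" where
  "proj_dim I = int (the_enat (krull_dim_quot I)) - 1"

definition mscale :: "'k::field \<Rightarrow> ('v, 'k) mpoly \<Rightarrow> ('v, 'k) mpoly" where
  "mscale c f = Poly_Mapping.map (\<lambda>x. c * x) f"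

definition kdim :: "('v, 'k::field) mpoly set \<Rightarrow> nat" where
  "kdim V = vector_space.dim mscale V"

text \<open>Hilbert function h_I(m) = dim_k (k[x]/I)_m = dim_k S_m - dim_k I_m.\<close>
definition hilbert_fun :: "('v::finite, 'k::field) mpoly set \<Rightarrow> nat \<Rightarrow> nat" where
  "hilbert_fun I m = kdim (hom_part m :: ('v,'k) mpoly set) - kdim (I \<inter> hom_part m)"

definition hilbert_poly :: "('v::finite, 'k::field) mpoly set \<Rightarrow> real poly" where
  "hilbert_poly I = (THE p. \<forall>\<^sub>F m in sequentially. real (hilbert_fun I m) = poly p (real m))"

definition ideal_deg :: "('v::finite, 'k::field) mpoly set \<Rightarrow> real" where
  "ideal_deg I = fact (nat (proj_dim I)) * coeff (hilbert_poly I) (nat (proj_dim I))"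

text \<open>Binomial coefficient with (integer) top argument; 0 when the top is negative
  (for 0 <= a < b the generalized binomial is already 0).\<close>
definition binom :: "real \<Rightarrow> nat \<Rightarrow> real" where
  "binom a b = (if a < 0 then 0 else a gchoose b)"

end

theory Submission
  imports Defs "HOL-Library.Multiset" "HOL-Library.FuncSet" "HOL-Library.Disjoint_Sets"
begin

text \<open>
  Passing to leading monomials replaces \<open>I\<close> by the set of monomials that do not lead an element of
  \<open>I\<close>, a down-closed subset \<open>X\<close> of \<open>\<nat>\<^sup>n\<^sup>+\<^sup>1\<close> with \<open>h\<^sub>I m\<close> elements of degree \<open>m\<close>. Such a set is a
  finite disjoint union of cones \<open>u + \<nat>\<^sup>Z\<close>; these give the Hilbert polynomial, and \<open>deg I\<close> is the
  number of cones with \<open>card Z = d + 1\<close>, provided that no larger \<open>Z\<close> occurs. The top-dimensional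
  cones contained in \<open>X\<close> can be translated within themselves so as to become pairwise disjoint, the
  \<open>i\<close>-th one having its apex in degree at most \<open>i\<close>, and counting points of degree \<open>m\<close> gives
  \<open>h\<^sub>I m \<ge> (\<Sum>i<deg I. (m - i + d) choose d)\<close>, which is the bound. No extension of the field is needed.

  That no \<open>Z\<close> has more than \<open>d + 1\<close> elements is the inequality between growth and Krull dimension.
  A homogeneous ideal that is maximal among those whose Hilbert function has a given growth is prime,
  and adding a variable outside it lowers the growth by at most one degree, so fast growth yields
  long chains of primes. Conversely, along a chain of primes the growth of the affine Hilbert
  function drops at each step; hence chains have bounded length, and the supremum defining the
  Krull dimension is finite.
\<close>

subsection \<open>Cones in down-closed sets of exponent vectors\<close>

definition fdeg :: "('v::finite \<Rightarrow> nat) \<Rightarrow> nat" where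
  "fdeg f = (\<Sum>v\<in>UNIV. f v)"

definition level :: "nat \<Rightarrow> ('v::finite \<Rightarrow> nat) set \<Rightarrow> ('v \<Rightarrow> nat) set" where
  "level m X = {f \<in> X. fdeg f = m}"

definition downset :: "('v \<Rightarrow> nat) set \<Rightarrow> bool" where
  "downset X \<longleftrightarrow> (\<forall>f\<in>X. \<forall>g. g \<le> f \<longrightarrow> g \<in> X)"

text \<open>The dimension of the cone is \<open>card Z\<close>; for \<open>Z = {}\<close> it is the
  single point \<open>u\<close>.\<close>

definition cone :: "('v \<Rightarrow> nat) \<Rightarrow> 'v set \<Rightarrow> ('v \<Rightarrow> nat) set" where
  "cone u Z = {f. (\<forall>v\<in>Z. u v \<le> f v) \<and> (\<forall>v. v \<notin> Z \<longrightarrow> f v = u v)}"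

section \<open>Degrees and the number of points of a cone in a given degree\<close>

lemma le_fdeg: "f v \<le> fdeg f"
  unfolding fdeg_def by (rule member_le_sum) auto

lemma fdeg_add: "fdeg (\<lambda>v. f v + g v) = fdeg f + fdeg g"
  by (simp add: fdeg_def sum.distrib)

lemma fdeg_mono: "f \<le> g \<Longrightarrow> fdeg f \<le> fdeg g"
  unfolding fdeg_def by (intro sum_mono) (simp add: le_fun_def)

lemma bounded_functions:
  shows finite_bounded_functions: "finite {f::'v::finite \<Rightarrow> nat. \<forall>v. f v \<le> m}"
    and card_bounded_functions: "card {f::'v \<Rightarrow> nat. \<forall>v. f v \<le> m} = (m + 1) ^ card (UNIV :: 'v set)"
proof -
  have eq: "{f::'v \<Rightarrow> nat. \<forall>v. f v \<le> m} = PiE UNIV (\<lambda>_. {..m})"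
    by (auto simp: PiE_def Pi_def)
  show "finite {f::'v::finite \<Rightarrow> nat. \<forall>v. f v \<le> m}"
    unfolding eq by (rule finite_PiE) auto
  show "card {f::'v \<Rightarrow> nat. \<forall>v. f v \<le> m} = (m + 1) ^ card (UNIV :: 'v set)"
    unfolding eq by (subst card_PiE) auto
qed

lemma finite_fdeg_le: "finite {f::'v::finite \<Rightarrow> nat. fdeg f \<le> m}"
  by (rule finite_subset[OF _ finite_bounded_functions[of m]]) (use le_fdeg order_trans in blast)

lemma finite_level [simp]: "finite (level m X)"
  by (rule finite_subset[OF _ finite_fdeg_le[of m]]) (auto simp: level_def)

lemma card_fdeg_le: "card {f::'v::finite \<Rightarrow> nat. fdeg f \<le> m} \<le> (m + 1) ^ card (UNIV :: 'v set)"
  unfolding card_bounded_functions[symmetric]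
  by (rule card_mono[OF finite_bounded_functions]) (use le_fdeg order_trans in blast)

lemma level_mono: "X \<subseteq> Y \<Longrightarrow> level m X \<subseteq> level m Y"
  by (auto simp: level_def)

lemma cone_le: "f \<in> cone u Z \<Longrightarrow> u \<le> f"
  unfolding cone_def le_fun_def by (metis (mono_tags, lifting) mem_Collect_eq order_refl)

lemma size_eq_sum_count: "size M = (\<Sum>v\<in>(UNIV::'v::finite set). count M v)"
  by (simp add: size_multiset_overloaded_eq) (rule sum.mono_neutral_left; auto simp: count_eq_zero_iff)

text \<open>Subtracting the apex leaves exponent vectors supported on \<open>Z\<close> of total
  degree \<open>m - fdeg u\<close>, which are the same as multisets of that size over
  \<open>Z\<close>; these can be counted by \<open>card_multisets_of_size\<close>.\<close>

lemma bij_betw_level_cone: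
  fixes u :: "'v::finite \<Rightarrow> nat"
  assumes "fdeg u \<le> m"
  shows "bij_betw (\<lambda>M v. u v + count M v) (multisets_of_size Z (m - fdeg u)) (level m (cone u Z))"
proof (rule bij_betwI[where g = "\<lambda>f. Abs_multiset (\<lambda>v. f v - u v)"])
  show "(\<lambda>M v. u v + count M v) \<in> multisets_of_size Z (m - fdeg u) \<rightarrow> level m (cone u Z)"
    using assms
    by (auto simp: multisets_of_size_def level_def cone_def fdeg_add count_eq_zero_iff)
       (simp add: fdeg_def size_eq_sum_count)
next
  have fin: "count (Abs_multiset g) = g" for g :: "'v \<Rightarrow> nat"
    by (rule count_Abs_multiset) (rule finite)
  show "(\<lambda>f. Abs_multiset (\<lambda>v. f v - u v)) \<in> level m (cone u Z) \<rightarrow> multisets_of_size Z (m - fdeg u)"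
  proof
    fix f assume f: "f \<in> level m (cone u Z)"
    then have le: "u v \<le> f v" and eq: "v \<notin> Z \<Longrightarrow> f v = u v" and deg: "fdeg f = m" for v
      using cone_le[of f u Z] by (auto simp: level_def cone_def le_fun_def)
    have "fdeg (\<lambda>v. (f v - u v) + u v) = m" using le deg by simp
    then have "fdeg (\<lambda>v. f v - u v) = m - fdeg u" by (subst (asm) fdeg_add) simp
    moreover have "set_mset (Abs_multiset (\<lambda>v. f v - u v)) \<subseteq> Z"
      using eq fin by (metis (no_types, lifting) count_eq_zero_iff diff_self_eq_0 subsetI)
    ultimately show "Abs_multiset (\<lambda>v. f v - u v) \<in> multisets_of_size Z (m - fdeg u)"
      by (simp add: multisets_of_size_def size_eq_sum_count fin fdeg_def)
  qed
  show "Abs_multiset (\<lambda>v. u v + count M v - u v) = M" for M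
    by (simp add: multiset_eq_iff fin)
  show "(\<lambda>v. u v + count (Abs_multiset (\<lambda>v. f v - u v)) v) = f" if "f \<in> level m (cone u Z)" for f
  proof
    fix v
    have "u v \<le> f v" using that cone_le[of f u Z] by (auto simp: level_def le_fun_def)
    then show "u v + count (Abs_multiset (\<lambda>v. f v - u v)) v = f v" by (simp add: fin)
  qed
qed

text \<open>The formula also covers \<open>Z = {}\<close>: truncated subtraction gives
  \<open>0 choose 0 = 1\<close> in the degree of the apex and \<open>(k - 1) choose k = 0\<close> at
  distance \<open>k > 0\<close> above it.\<close>

lemma card_level_cone:
  fixes u :: "'v::finite \<Rightarrow> nat"
  shows "card (level m (cone u Z)) = (if fdeg u \<le> m then (card Z + (m - fdeg u) - 1) choose (m - fdeg u) else 0)"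
proof (cases "fdeg u \<le> m")
  case True
  then show ?thesis using bij_betw_same_card[OF bij_betw_level_cone[OF True, of Z]]
    by (simp add: card_multisets_of_size)
next
  case False
  then have "level m (cone u Z) = {}" using cone_le fdeg_mono by (fastforce simp: level_def)
  then show ?thesis using False by simp
qed

text \<open>By symmetry of binomial coefficients the lower index becomes the constant
  \<open>c\<close>, so that beyond the apex the count is visibly a polynomial in \<open>m\<close> of
  degree \<open>c\<close>.\<close>

lemma card_level_cone_Suc:
  assumes "card Z = Suc c"
  shows "card (level m (cone u Z)) = (if fdeg u \<le> m then (m - fdeg u + c) choose c else 0)"
proof -
  have "(c + k) choose k = (k + c) choose c" for k
    using binomial_symmetric[of k "k + c"] by (simp add: add.commute)
  then show ?thesis by (simp add: card_level_cone assms del: add_diff_assoc)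
qed

lemma card_level_cone_empty:
  assumes "m > fdeg u"
  shows "card (level m (cone u {})) = 0"
  using assms by (simp add: card_level_cone)

section \<open>Dickson's lemma and the descending chain condition for down-closed sets\<close>

text \<open>The sequence is thinned out one coordinate at a time until all coordinates are
  nondecreasing along a common subsequence.\<close>

lemma dickson:
  fixes s :: "nat \<Rightarrow> 'v::finite \<Rightarrow> nat"
  obtains i j where "i < j" "s i \<le> s j"
proof -
  have "\<exists>r::nat \<Rightarrow> nat. strict_mono r \<and> (\<forall>v\<in>V. \<forall>i j. i \<le> j \<longrightarrow> s (r i) v \<le> s (r j) v)" if "finite V" for V
    using that
  proof (induction V)
    case empty
    show ?case by (rule exI[of _ "\<lambda>i. i"]) (auto simp: strict_mono_def)
  next
    case (insert w V)
    from insert.IH obtain r :: "nat \<Rightarrow> nat" where "strict_mono r \<and> (\<forall>v\<in>V. \<forall>i j. i \<le> j \<longrightarrow> s (r i) v \<le> s (r j) v)" ..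
    then have r: "strict_mono r" "\<And>v i j. v \<in> V \<Longrightarrow> i \<le> j \<Longrightarrow> s (r i) v \<le> s (r j) v" by simp_all
    obtain t :: "nat \<Rightarrow> nat" where t: "strict_mono t" "monoseq (\<lambda>i. s (r (t i)) w)"
      using seq_monosub[of "\<lambda>i. s (r i) w"] by (auto simp: o_def)
    \<comment> \<open>A monotone subsequence might be nonincreasing, but then it is constant from
      the place where it takes its minimum.\<close>
    have "\<exists>N. \<forall>i\<ge>N. \<forall>j\<ge>i. s (r (t i)) w \<le> s (r (t j)) w"
    proof (cases "\<forall>i j. i \<le> j \<longrightarrow> s (r (t i)) w \<le> s (r (t j)) w")
      case True then show ?thesis by blast
    next
      case False
      then have dec: "\<And>i j. i \<le> j \<Longrightarrow> s (r (t j)) w \<le> s (r (t i)) w"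
        using t(2) unfolding monoseq_def by blast
      obtain N where N: "\<And>k. s (r (t N)) w \<le> s (r (t k)) w"
        using ex_has_least_nat[of "\<lambda>_. True" _ "\<lambda>k. s (r (t k)) w"] by blast
      show ?thesis using N dec by (meson order_trans)
    qed
    then obtain N where N: "\<And>i j. N \<le> i \<Longrightarrow> i \<le> j \<Longrightarrow> s (r (t i)) w \<le> s (r (t j)) w" by blast
    show ?case
    proof (intro exI[of _ "\<lambda>i. r (t (N + i))"] conjI ballI allI impI)
      show "strict_mono (\<lambda>i. r (t (N + i)))" using r(1) t(1) by (simp add: strict_mono_def)
      fix v i j assume v: "v \<in> insert w V" and ij: "i \<le> (j::nat)"
      have "t (N + i) \<le> t (N + j)" using t(1) ij by (simp add: strict_mono_less_eq)
      then show "s (r (t (N + i))) v \<le> s (r (t (N + j))) v" using v r(2) N[of "N+i" "N+j"] ij by auto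
    qed
  qed
  from this[of UNIV] obtain r :: "nat \<Rightarrow> nat" where r: "strict_mono r" "\<And>v i j. i \<le> j \<Longrightarrow> s (r i) v \<le> s (r j) v" by auto
  show ?thesis
    by (rule that[of "r 0" "r 1"]) (use r in \<open>auto simp: strict_mono_def le_fun_def\<close>)
qed

text \<open>Down-closed sets are the complements of monomial ideals, so this is the ascending chain
  condition for the latter. In an infinite descent choose \<open>s i\<close> in
  \<open>D i - D (Suc i)\<close>. Dickson's lemma gives \<open>i < j\<close> with
  \<open>s i \<le> s j\<close>; as \<open>s j\<close> lies in \<open>D (Suc i)\<close>, so does
  \<open>s i\<close>, a contradiction.\<close>

lemma wf_downsets: "wf {(X, Y :: ('v::finite \<Rightarrow> nat) set). downset X \<and> downset Y \<and> X \<subset> Y}"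
  unfolding wf_iff_no_infinite_down_chain
proof
  assume "\<exists>D. \<forall>i. (D (Suc i), D i) \<in> {(X, Y :: ('v::finite \<Rightarrow> nat) set). downset X \<and> downset Y \<and> X \<subset> Y}"
  then obtain D :: "nat \<Rightarrow> ('v \<Rightarrow> nat) set"
    where "\<forall>i. (D (Suc i), D i) \<in> {(X, Y). downset X \<and> downset Y \<and> X \<subset> Y}" ..
  then have D: "\<And>i. downset (D i)" "\<And>i. D (Suc i) \<subset> D i" by simp_all
  have anti: "D j \<subseteq> D i" if "i \<le> j" for i j
    by (rule lift_Suc_antimono_le[OF _ that]) (use D(2) in blast)
  have "\<forall>i. \<exists>x. x \<in> D i - D (Suc i)" using D(2) by blast
  then obtain s where s: "\<And>i. s i \<in> D i - D (Suc i)" by metis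
  obtain i j where "i < j" "s i \<le> s j" using dickson .
  then have "s j \<in> D (Suc i)" using anti[of "Suc i" j] s[of j] by auto
  then have "s i \<in> D (Suc i)" using D(1)[of "Suc i"] \<open>s i \<le> s j\<close> by (auto simp: downset_def)
  then show False using s by blast
qed

lemma decreasing_downsets_stabilise:
  fixes D :: "nat \<Rightarrow> ('v::finite \<Rightarrow> nat) set"
  assumes "\<And>i. downset (D i)" "\<And>i j. i \<le> j \<Longrightarrow> D j \<subseteq> D i"
  obtains N where "\<And>i. N \<le> i \<Longrightarrow> D i = D N"
proof -
  obtain X where X: "X \<in> range D"
      "\<And>Y. (Y, X) \<in> {(X, Y). downset X \<and> downset Y \<and> X \<subset> Y} \<Longrightarrow> Y \<notin> range D"
    by (rule wfE_min[OF wf_downsets, of "D 0" "range D"]) auto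
  then obtain N where N: "X = D N" by blast
  have "D i = D N" if "N \<le> i" for i
    using X(2)[of "D i"] assms(1)[of i] assms(1)[of N] assms(2)[OF that] N by auto
  then show ?thesis by (rule that)
qed

section \<open>Decomposition of a down-closed set into disjoint cones\<close>

lemma mem_cone_upd: "w \<notin> Z \<Longrightarrow> f \<in> cone (u(w := i)) Z \<longleftrightarrow> f w = i \<and> f(w := u w) \<in> cone u Z"
  unfolding cone_def by auto

lemma mem_cone_upd_insert: "w \<notin> Z \<Longrightarrow> f \<in> cone (u(w := i)) (insert w Z) \<longleftrightarrow> f w \<ge> i \<and> f(w := u w) \<in> cone u Z"
  unfolding cone_def by auto

text \<open>Induction on the set \<open>V\<close> of coordinates that may be nonzero. The slices
  along a new coordinate \<open>w\<close> form a descending sequence of down-closed sets and are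
  constant from some height \<open>N\<close> on. Slices below \<open>N\<close> contribute their
  cones at fixed height; the slice at \<open>N\<close> contributes its cones with \<open>w\<close>
  as an additional free direction.\<close>

lemma cone_decomposition_support:
  fixes V :: "'v::finite set"
  shows "downset X \<Longrightarrow> \<forall>f\<in>X. \<forall>v. v \<notin> V \<longrightarrow> f v = 0 \<Longrightarrow>
    \<exists>C. finite C \<and> (\<forall>(u,Z)\<in>C. Z \<subseteq> V \<and> (\<forall>v. v \<notin> V \<longrightarrow> u v = 0)) \<and>
      X = (\<Union>(u,Z)\<in>C. cone u Z) \<and> disjoint_family_on (\<lambda>(u,Z). cone u Z) C"
  using finite[of V]
proof (induction V arbitrary: X rule: finite_induct)
  case empty
  show ?case
  proof (cases "X = {}")
    case True
    then show ?thesis by (intro exI[of _ "{}"]) (auto simp: disjoint_family_on_def)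
  next
    case False
    have "f = (\<lambda>_. 0)" if "f \<in> X" for f using empty.prems(2) that by (auto simp: fun_eq_iff)
    with False have "X = {\<lambda>_. 0}" by auto
    moreover have "cone (\<lambda>_. 0) {} = {\<lambda>_::'v. 0}" by (auto simp: cone_def)
    ultimately show ?thesis by (intro exI[of _ "{(\<lambda>_. 0, {})}"]) (auto simp: disjoint_family_on_def)
  qed
next
  case (insert w V X)
  \<comment> \<open>The slice at height \<open>i\<close> is projected to \<open>w = 0\<close>, so
    that the induction hypothesis applies to it and slices at different heights can be
    compared.\<close>
  define S where "S i = {f. f w = 0 \<and> f(w := i) \<in> X}" for i :: nat
  have S_down: "downset (S i)" for i
    unfolding downset_def
  proof (intro ballI allI impI)
    fix f g assume "f \<in> S i" "g \<le> f"
    then have f: "f w = 0" "f(w := i) \<in> X" by (simp_all add: S_def)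
    have "g w \<le> f w" using \<open>g \<le> f\<close> by (rule le_funD)
    moreover have "g(w := i) \<le> f(w := i)" using \<open>g \<le> f\<close> by (simp add: le_fun_def)
    ultimately show "g \<in> S i" using insert.prems(1) f by (auto simp: S_def downset_def)
  qed
  have S_supp: "\<forall>f\<in>S i. \<forall>v. v \<notin> V \<longrightarrow> f v = 0" for i
  proof (intro ballI allI impI)
    fix f v assume "f \<in> S i" "v \<notin> V"
    then have f: "f w = 0" "f(w := i) \<in> X" by (simp_all add: S_def)
    show "f v = 0"
    proof (cases "v = w")
      case False
      then have "(f(w := i)) v = 0" using insert.prems(2) f(2) \<open>v \<notin> V\<close> by blast
      then show ?thesis using False by simp
    qed (use f in simp)
  qed
  have S_anti: "S j \<subseteq> S i" if "i \<le> j" for i j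
  proof
    fix f assume "f \<in> S j"
    then have f: "f w = 0" "f(w := j) \<in> X" by (simp_all add: S_def)
    have "f(w := i) \<le> f(w := j)" using that by (simp add: le_fun_def)
    then show "f \<in> S i" using insert.prems(1) f by (auto simp: S_def downset_def)
  qed
  obtain N where N: "\<And>i. N \<le> i \<Longrightarrow> S i = S N" 
    using decreasing_downsets_stabilise[of S, OF S_down S_anti] by blast
  define Q where "Q i C \<longleftrightarrow> finite C \<and> (\<forall>(u,Z)\<in>C. Z \<subseteq> V \<and> (\<forall>v. v \<notin> V \<longrightarrow> u v = 0)) \<and>
      S i = (\<Union>(u,Z)\<in>C. cone u Z) \<and> disjoint_family_on (\<lambda>(u,Z). cone u Z) C" for i C
  have "\<forall>i. \<exists>C. Q i C"
    unfolding Q_def using insert.IH[OF S_down S_supp] by simp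
  then obtain C where "\<forall>i. Q i (C i)" by (rule choice[THEN exE])
  then have C: "\<And>i. finite (C i)" "\<And>i u Z. (u,Z) \<in> C i \<Longrightarrow> Z \<subseteq> V \<and> (\<forall>v. v \<notin> V \<longrightarrow> u v = 0)"
      "\<And>i. S i = (\<Union>(u,Z)\<in>C i. cone u Z)" "\<And>i. disjoint_family_on (\<lambda>(u,Z). cone u Z) (C i)"
    unfolding Q_def by simp_all blast
  define T where "T = (SIGMA i:{..N}. C i)"
  \<comment> \<open>Setting \<open>w\<close> free only at height \<open>N\<close> accounts for all
    heights from \<open>N\<close> on at once.\<close>
  define h where "h = (\<lambda>(i, u :: 'v \<Rightarrow> nat, Z). (u(w := i), if i = N then insert w Z else Z))"
  have cw: "u w = 0" "w \<notin> Z" if "(u,Z) \<in> C i" for i u Z using C(2)[OF that] insert.hyps by auto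
  \<comment> \<open>A point determines the height \<open>min (f w) N\<close> of every cone that
    contains it; both covering and disjointness reduce to the corresponding facts about that one
    slice.\<close>
  have mem: "f \<in> cone (u(w := i)) (if i = N then insert w Z else Z)
      \<longleftrightarrow> i = min (f w) N \<and> f(w := 0) \<in> cone u Z" if "(u,Z) \<in> C i" "i \<le> N" for f u i Z
    using that(2) cw[OF that(1)] by (cases "i = N") (simp_all add: mem_cone_upd_insert mem_cone_upd, auto)
  have inX: "f \<in> X \<longleftrightarrow> f(w := 0) \<in> S (min (f w) N)" for f
  proof -
    have "f \<in> X \<longleftrightarrow> f(w := 0) \<in> S (f w)" by (simp add: S_def)
    also have "S (f w) = S (min (f w) N)" using N[of "f w"] by (cases "N \<le> f w") (auto simp: min_def)
    finally show ?thesis .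
  qed
  show ?case
  proof (intro exI[of _ "h ` T"] conjI)
    show "finite (h ` T)" using C(1) by (auto simp: T_def)
    show "\<forall>(u,Z)\<in>h ` T. Z \<subseteq> insert w V \<and> (\<forall>v. v \<notin> insert w V \<longrightarrow> u v = 0)"
      by (auto simp: h_def T_def split: if_splits dest!: C(2))
    show "X = (\<Union>(u,Z)\<in>h ` T. cone u Z)"
    proof (rule set_eqI)
      fix f
      have "f \<in> X \<longleftrightarrow> (\<exists>u Z. (u,Z) \<in> C (min (f w) N) \<and> f(w := 0) \<in> cone u Z)"
        unfolding inX C(3) by auto
      also have "\<dots> \<longleftrightarrow> (\<exists>i u Z. i \<le> N \<and> (u,Z) \<in> C i \<and> i = min (f w) N \<and> f(w := 0) \<in> cone u Z)"
        by (metis min.cobounded2)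
      also have "\<dots> \<longleftrightarrow> (\<exists>i u Z. i \<le> N \<and> (u,Z) \<in> C i \<and>
          f \<in> cone (u(w := i)) (if i = N then insert w Z else Z))"
        by (intro ex_cong1 conj_cong refl mem[symmetric])
      also have "\<dots> \<longleftrightarrow> f \<in> (\<Union>(u,Z)\<in>h ` T. cone u Z)"
        unfolding h_def T_def by (simp add: Bex_def split_paired_Ex)
      finally show "f \<in> X \<longleftrightarrow> f \<in> (\<Union>(u,Z)\<in>h ` T. cone u Z)" .
    qed
    show "disjoint_family_on (\<lambda>(u,Z). cone u Z) (h ` T)"
      unfolding disjoint_family_on_def
    proof (intro ballI impI)
      fix x y assume xy: "x \<in> h ` T" "y \<in> h ` T" "x \<noteq> y"
      obtain i u Z where x: "x = h (i,u,Z)" "(u,Z) \<in> C i" "i \<le> N" using xy by (auto simp: T_def)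
      obtain j u' Z' where y: "y = h (j,u',Z')" "(u',Z') \<in> C j" "j \<le> N" using xy by (auto simp: T_def)
      have "False" if "f \<in> cone (u(w := i)) (if i = N then insert w Z else Z)"
        "f \<in> cone (u'(w := j)) (if j = N then insert w Z' else Z')" for f
      proof -
        have ij: "i = j" and f: "f(w := 0) \<in> cone u Z" "f(w := 0) \<in> cone u' Z'"
          using that(1)[unfolded mem[OF x(2,3)]] that(2)[unfolded mem[OF y(2,3)]] by simp_all
        then have "(u,Z) = (u',Z')" using C(4)[of i] x(2) y(2) unfolding disjoint_family_on_def by fastforce
        then show False using ij x y xy(3) by simp
      qed
      then show "(case x of (u,Z) \<Rightarrow> cone u Z) \<inter> (case y of (u,Z) \<Rightarrow> cone u Z) = {}"
        unfolding x(1) y(1) h_def by auto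
    qed
  qed
qed

lemma cone_decomposition:
  fixes X :: "('v::finite \<Rightarrow> nat) set"
  assumes "downset X"
  obtains C where "finite C" "X = (\<Union>(u,Z)\<in>C. cone u Z)" "disjoint_family_on (\<lambda>(u,Z). cone u Z) C"
  using cone_decomposition_support[OF assms, of UNIV] by auto

section \<open>Lower bounds for down-closed sets by packing translated cones\<close>

lemma fdeg_intermediate:
  fixes f :: "'v::finite \<Rightarrow> nat"
  assumes "j \<le> fdeg f"
  shows "\<exists>g\<le>f. fdeg g = j"
  using assms
proof (induction "fdeg f" arbitrary: f)
  case 0
  then show ?case by auto
next
  case (Suc n)
  show ?case
  proof (cases "j = Suc n")
    case True
    then show ?thesis using Suc.hyps(2) by auto
  next
    case False
    obtain v where v: "f v > 0"
    proof (rule ccontr)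
      assume "\<not> thesis"
      then have "f = (\<lambda>_. 0)" using that by auto
      then show False using Suc.hyps(2) by (simp add: fdeg_def)
    qed
    have "fdeg f = f v + (\<Sum>x\<in>UNIV - {v}. f x)" unfolding fdeg_def by (rule sum.remove) auto
    moreover have "fdeg (f(v := f v - 1)) = (f v - 1) + (\<Sum>x\<in>UNIV - {v}. f x)"
      unfolding fdeg_def by (subst sum.remove[of _ v]) (auto intro!: sum.cong)
    ultimately have "n = fdeg (f(v := f v - 1))" using v Suc.hyps(2) by simp
    moreover have "j \<le> n" using False Suc.prems Suc.hyps(2) by simp
    ultimately obtain g where "g \<le> f(v := f v - 1)" "fdeg g = j" using Suc.hyps(1)[of "f(v := f v - 1)"] by auto
    moreover have "f(v := f v - 1) \<le> f" by (simp add: le_fun_def)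
    ultimately show ?thesis by (intro exI[of _ g]) (simp add: order_trans[of g "f(v := f v - 1)" f])
  qed
qed

text \<open>Below \<open>w\<close> the set has elements of each of the degrees
  \<open>0, ..., fdeg w\<close>.\<close>

lemma fdeg_less_card_downset:
  fixes U :: "('v::finite \<Rightarrow> nat) set"
  assumes "finite U" "downset U" "w \<in> U"
  shows "fdeg w < card U"
proof -
  have "j \<in> fdeg ` U" if j: "j \<le> fdeg w" for j
  proof -
    obtain g where "g \<le> w" "fdeg g = j" using fdeg_intermediate[OF j] by blast
    then show ?thesis using assms(2,3) by (auto simp: downset_def)
  qed
  then have "{..fdeg w} \<subseteq> fdeg ` U" by auto
  then have "card {..fdeg w} \<le> card (fdeg ` U)" using assms(1) by (intro card_mono) auto
  then show ?thesis using card_image_le[OF assms(1), of fdeg] by simp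
qed

text \<open>Removing an element of maximal degree leaves a down-closed set, and from
  \<open>n + 1\<close> elements the one removed has degree at most \<open>n\<close>. Thus
  \<open>U\<close> can be enumerated so that the element with index \<open>i\<close> has degree at
  most \<open>i\<close>.\<close>

lemma sum_downset_ge:
  fixes U :: "('v::finite \<Rightarrow> nat) set" and g :: "nat \<Rightarrow> nat"
  assumes "finite U" "downset U" "antimono g"
  shows "(\<Sum>i<card U. g i) \<le> (\<Sum>w\<in>U. g (fdeg w))"
  using assms(1,2)
proof (induction "card U" arbitrary: U)
  case 0
  then show ?case by simp
next
  case (Suc n)
  then have "U \<noteq> {}" by auto
  then have "Max (fdeg ` U) \<in> fdeg ` U" using Suc.prems(1) by simp
  then obtain w where "w \<in> U" "fdeg w = Max (fdeg ` U)" by auto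
  then have w: "w \<in> U" "\<And>x. x \<in> U \<Longrightarrow> fdeg x \<le> fdeg w" using Suc.prems(1) by simp_all
  have down: "downset (U - {w})"
    unfolding downset_def
  proof (intro ballI allI impI)
    fix f g assume f: "f \<in> U - {w}" and "g \<le> f"
    then have "g \<in> U" using Suc.prems(2) by (auto simp: downset_def)
    moreover have "g \<noteq> w"
    proof
      assume "g = w"
      then have "w \<le> f" "fdeg f \<le> fdeg w" using \<open>g \<le> f\<close> f w(2) by auto
      have "f v \<le> w v" for v
      proof (rule ccontr)
        assume "\<not> f v \<le> w v"
        then have "fdeg w < fdeg f" unfolding fdeg_def
          by (intro sum_strict_mono_ex1) (use \<open>w \<le> f\<close> in \<open>auto simp: le_fun_def not_le\<close>)
        then show False using \<open>fdeg f \<le> fdeg w\<close> by simp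
      qed
      then have "f = w" using \<open>w \<le> f\<close> by (auto simp: le_fun_def fun_eq_iff intro: antisym)
      then show False using f by simp
    qed
    ultimately show "g \<in> U - {w}" by simp
  qed
  have card: "card (U - {w}) = n" using Suc.hyps(2) w(1) Suc.prems(1) by simp
  have "(\<Sum>i<card U. g i) = (\<Sum>i<n. g i) + g n" using Suc.hyps(2) by (metis sum.lessThan_Suc)
  also have "\<dots> \<le> (\<Sum>x\<in>U - {w}. g (fdeg x)) + g (fdeg w)"
  proof (rule add_mono)
    show "(\<Sum>i<n. g i) \<le> (\<Sum>x\<in>U - {w}. g (fdeg x))"
      using Suc.hyps(1)[of "U - {w}"] card down Suc.prems(1) by simp
    have "fdeg w \<le> n" using fdeg_less_card_downset[OF Suc.prems w(1)] Suc.hyps(2) by simp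
    then show "g n \<le> g (fdeg w)" using assms(3) by (simp add: antimono_def)
  qed
  also have "\<dots> = (\<Sum>x\<in>U. g (fdeg x))" using w(1) Suc.prems(1) by (simp add: sum.remove add.commute)
  finally show ?case .
qed

text \<open>The number of points of degree \<open>m\<close> in a \<open>(d+1)\<close>-dimensional cone whose apex has degree \<open>i\<close>.\<close>

definition cone_count :: "nat \<Rightarrow> nat \<Rightarrow> nat \<Rightarrow> nat" where
  "cone_count d m i = (if i \<le> m then (m - i + d) choose d else 0)"

lemma antimono_cone_count: "antimono (cone_count d m)"
  by (auto simp: antimono_def cone_count_def intro!: binomial_right_mono)

lemma sum_lessThan_add:
  fixes g :: "nat \<Rightarrow> nat"
  shows "(\<Sum>i<a + b. g i) = (\<Sum>i<a. g i) + (\<Sum>i<b. g (i + a))"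
  by (induction b) (simp_all add: ac_simps)

text \<open>Induction over the directions. The cones in a new direction \<open>Z\<close> are
  translated within themselves by a vector \<open>b\<close> of degree \<open>T\<close>, the number
  of cones treated before, and thereby become disjoint from all earlier cones. Their apexes now have
  degree \<open>fdeg w + T\<close>, so the new summands continue at index \<open>T\<close>, where
  the earlier sum stops.\<close>

lemma card_level_cones_ge:
  fixes U :: "'v::finite set \<Rightarrow> ('v \<Rightarrow> nat) set"
  assumes "finite A" "\<And>Z. Z \<in> A \<Longrightarrow> card Z = Suc d"
    and "\<And>Z. Z \<in> A \<Longrightarrow> finite (U Z) \<and> downset (U Z) \<and> (\<forall>w\<in>U Z. \<forall>v\<in>Z. w v = 0)"
  shows "(\<Sum>i<(\<Sum>Z\<in>A. card (U Z)). cone_count d m i) \<le> card (level m (\<Union>Z\<in>A. \<Union>w\<in>U Z. cone w Z))"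
  using assms
proof (induction A rule: finite_induct)
  case empty
  then show ?case by simp
next
  case (insert Z A)
  define T where "T = (\<Sum>Z\<in>A. card (U Z))"
  define X where "X = (\<Union>Z\<in>A. \<Union>w\<in>U Z. cone w Z)"
  have cardZ: "card Z = Suc d" using insert.prems(1) by simp
  have UZ: "finite (U Z)" "downset (U Z)" "\<And>w v. w \<in> U Z \<Longrightarrow> v \<in> Z \<Longrightarrow> w v = 0"
    using insert.prems(2)[of Z] by auto
  have "\<exists>v. v \<in> Z - Z'" if "Z' \<in> A" for Z'
  proof (rule ccontr)
    assume "\<not> ?thesis"
    then have "Z \<subseteq> Z'" by blast
    then have "Z = Z'" using card_subset_eq[of Z' Z] insert.prems(1)[of Z'] cardZ that by simp
    then show False using that insert.hyps by simp
  qed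
  then obtain ch where ch: "\<And>Z'. Z' \<in> A \<Longrightarrow> ch Z' \<in> Z - Z'" by metis
  \<comment> \<open>Shifting by \<open>b\<close> separates every cone in direction \<open>Z\<close> from all earlier ones in direction
    \<open>Z'\<close>: along the coordinate \<open>ch Z'\<close> the latter stay below \<open>card (U Z')\<close>.\<close>
  define b where "b v = (\<Sum>Z'\<in>{Z'\<in>A. ch Z' = v}. card (U Z'))" for v
  have b0: "b v = 0" if "v \<notin> Z" for v
  proof -
    have "{Z'\<in>A. ch Z' = v} = {}" using ch that by blast
    then show ?thesis by (simp only: b_def) simp
  qed
  \<comment> \<open>Each \<open>Z'\<close> contributes \<open>card (U Z')\<close> to exactly one
    coordinate of \<open>b\<close>, namely \<open>ch Z'\<close>.\<close>
  have fdeg_b: "fdeg b = T"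
    unfolding fdeg_def b_def T_def by (rule sum.group) (use insert.hyps in auto)
  have b_ge: "card (U Z') \<le> b (ch Z')" if "Z' \<in> A" for Z'
    unfolding b_def by (rule member_le_sum) (use that insert.hyps in auto)
  define N where "N w = level m (cone (\<lambda>v. w v + b v) Z)" for w
  have finN: "finite (N w)" for w by (simp add: N_def)
  have cardN: "card (N w) = cone_count d m (fdeg w + T)" for w
    unfolding N_def card_level_cone_Suc[OF cardZ] fdeg_add fdeg_b cone_count_def by simp
  have N_sub: "N w \<subseteq> level m (cone w Z)" for w
    unfolding N_def using b0 by (intro level_mono) (fastforce simp: cone_def)
  have disjN: "N w \<inter> N w' = {}" if "w \<in> U Z" "w' \<in> U Z" "w \<noteq> w'" for w w'
  proof (rule ccontr)
    assume "N w \<inter> N w' \<noteq> {}"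
    then obtain f where f: "f \<in> cone w Z" "f \<in> cone w' Z" using N_sub by (fastforce simp: level_def)
    have "w v = w' v" for v
      using f UZ(3)[OF that(1), of v] UZ(3)[OF that(2), of v] by (cases "v \<in> Z") (auto simp: cone_def)
    then show False using that(3) by auto
  qed
  have disjX: "N w \<inter> level m X = {}" if "w \<in> U Z" for w
  proof (rule ccontr)
    assume "N w \<inter> level m X \<noteq> {}"
    then obtain f Z' w' where f: "f \<in> cone (\<lambda>v. w v + b v) Z" "Z' \<in> A" "w' \<in> U Z'" "f \<in> cone w' Z'"
      by (auto simp: N_def X_def level_def)
    have chZ: "ch Z' \<in> Z" "ch Z' \<notin> Z'" using ch[OF f(2)] by auto
    have "f (ch Z') = w' (ch Z')" using f(4) chZ by (simp add: cone_def)
    also have "\<dots> \<le> fdeg w'" by (rule le_fdeg)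
    also have "\<dots> < card (U Z')" using insert.prems(2)[of Z'] f by (intro fdeg_less_card_downset) auto
    also have "\<dots> \<le> b (ch Z')" by (rule b_ge[OF f(2)])
    also have "\<dots> \<le> f (ch Z')" using cone_le[OF f(1)] by (simp add: le_fun_def) (metis add_leD2)
    finally show False by simp
  qed
  have "(\<Sum>i<(\<Sum>Z\<in>insert Z A. card (U Z)). cone_count d m i)
      = (\<Sum>i<T. cone_count d m i) + (\<Sum>i<card (U Z). cone_count d m (i + T))"
    using insert.hyps by (simp add: T_def sum_lessThan_add[symmetric] add.commute)
  also have "\<dots> \<le> card (level m X) + (\<Sum>w\<in>U Z. cone_count d m (fdeg w + T))"
  proof (rule add_mono)
    show "(\<Sum>i<T. cone_count d m i) \<le> card (level m X)"
      unfolding T_def X_def by (rule insert.IH) (use insert.prems in blast)+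
    have "antimono (\<lambda>i. cone_count d m (i + T))"
      using antimono_cone_count[of d m] by (simp add: antimono_def)
    then show "(\<Sum>i<card (U Z). cone_count d m (i + T)) \<le> (\<Sum>w\<in>U Z. cone_count d m (fdeg w + T))"
      by (rule sum_downset_ge[OF UZ(1,2)])
  qed
  also have "\<dots> = card (level m X) + card (\<Union>w\<in>U Z. N w)"
    by (subst card_UN_disjoint) (use UZ(1) disjN finN in \<open>auto simp: cardN\<close>)
  also have "\<dots> = card (level m X \<union> (\<Union>w\<in>U Z. N w))"
    by (subst card_Un_disjoint) (use UZ(1) disjX finN in auto)
  also have "\<dots> \<le> card (level m (\<Union>Z\<in>insert Z A. \<Union>w\<in>U Z. cone w Z))"
  proof (rule card_mono[OF finite_level Un_least])
    show "level m X \<subseteq> level m (\<Union>Z\<in>insert Z A. \<Union>w\<in>U Z. cone w Z)"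
      by (rule level_mono) (auto simp: X_def)
    have "level m (cone w Z) \<subseteq> level m (\<Union>Z\<in>insert Z A. \<Union>w\<in>U Z. cone w Z)" if "w \<in> U Z" for w
      by (rule level_mono) (use that in auto)
    then show "(\<Union>w\<in>U Z. N w) \<subseteq> level m (\<Union>Z\<in>insert Z A. \<Union>w\<in>U Z. cone w Z)"
      using N_sub by blast
  qed
  finally show ?case .
qed

text \<open>For each direction \<open>Z\<close> of size \<open>d + 1\<close>, the apexes of the
  cones of \<open>C\<close> in that direction, with their \<open>Z\<close>-coordinates erased,
  generate a down-closed set \<open>U Z\<close>. All cones over \<open>U Z\<close> in direction
  \<open>Z\<close> stay inside \<open>X\<close>, and \<open>U Z\<close> has at least as many
  elements as \<open>C\<close> has cones in that direction, so the packing bound applies.\<close>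

lemma card_level_downset_ge:
  fixes X :: "('v::finite \<Rightarrow> nat) set"
  assumes "downset X" "finite C" and C: "X = (\<Union>(u,Z)\<in>C. cone u Z)" "disjoint_family_on (\<lambda>(u,Z). cone u Z) C"
  shows "(\<Sum>i<card {(u,Z)\<in>C. card Z = Suc d}. cone_count d m i) \<le> card (level m X)"
proof -
  define A :: "'v set set" where "A = {Z. card Z = Suc d}"
  define r where "r Z u = (\<lambda>v. if v \<in> Z then 0 else u v)" for Z and u :: "'v \<Rightarrow> nat"
  define U where "U Z = (\<Union>u\<in>{u. (u,Z) \<in> C}. {w. w \<le> r Z u})" for Z
  have finC: "finite {u. (u,Z) \<in> C}" for Z
    by (rule finite_subset[of _ "fst ` C"]) (use assms(2) in force)+
  have fin_below: "finite {w. w \<le> h}" for h :: "'v \<Rightarrow> nat"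
    by (rule finite_subset[OF _ finite_fdeg_le[of "fdeg h"]]) (auto intro: fdeg_mono)
  have UZ: "finite (U Z) \<and> downset (U Z) \<and> (\<forall>w\<in>U Z. \<forall>v\<in>Z. w v = 0)" for Z
  proof (intro conjI)
    show "finite (U Z)" unfolding U_def using finC fin_below by blast
    show "downset (U Z)" unfolding U_def downset_def by (auto intro: order_trans)
    show "\<forall>w\<in>U Z. \<forall>v\<in>Z. w v = 0"
    proof (intro ballI)
      fix w v assume "w \<in> U Z" "v \<in> Z"
      then obtain u where "w \<le> r Z u" by (auto simp: U_def)
      then have "w v \<le> r Z u v" by (rule le_funD)
      then show "w v = 0" using \<open>v \<in> Z\<close> by (simp add: r_def)
    qed
  qed
  have sub: "cone w Z \<subseteq> X" if w: "w \<in> U Z" for w Z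
  proof
    fix f assume f: "f \<in> cone w Z"
    obtain u where u: "(u,Z) \<in> C" "w \<le> r Z u" using w by (auto simp: U_def)
    \<comment> \<open>Raising the \<open>Z\<close>-coordinates above those of the apex yields a
      point of the original cone that dominates \<open>f\<close>.\<close>
    define g where "g v = (if v \<in> Z then max (f v) (u v) else u v)" for v
    have "g \<in> cone u Z" by (auto simp: cone_def g_def)
    then have "g \<in> X" using C(1) u(1) by auto
    moreover have "f \<le> g"
    proof (rule le_funI)
      fix v show "f v \<le> g v"
        using f le_funD[OF u(2), of v] by (cases "v \<in> Z") (auto simp: cone_def g_def r_def)
    qed
    ultimately show "f \<in> X" using assms(1) by (auto simp: downset_def)
  qed
  have inj: "inj_on (r Z) {u. (u,Z) \<in> C}" for Z
  proof (rule inj_onI)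
    fix u u' assume u: "u \<in> {u. (u,Z) \<in> C}" "u' \<in> {u. (u,Z) \<in> C}" "r Z u = r Z u'"
    have "u v = u' v" if "v \<notin> Z" for v using fun_cong[OF u(3), of v] that by (simp add: r_def)
    \<comment> \<open>Two cones in the same direction whose apexes agree off \<open>Z\<close> meet
      in the coordinatewise maximum of the apexes, against disjointness.\<close>
    then have "(\<lambda>v. max (u v) (u' v)) \<in> cone u Z \<inter> cone u' Z" by (auto simp: cone_def)
    then have "(u,Z) = (u',Z)" using C(2) u(1,2) unfolding disjoint_family_on_def by fastforce
    then show "u = u'" by simp
  qed
  have "card {u. (u,Z) \<in> C} \<le> card (U Z)" for Z
  proof -
    have "card {u. (u,Z) \<in> C} = card (r Z ` {u. (u,Z) \<in> C})" by (rule card_image[symmetric, OF inj])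
    also have "\<dots> \<le> card (U Z)" by (rule card_mono) (use UZ in \<open>auto simp: U_def\<close>)
    finally show ?thesis .
  qed
  then have "(\<Sum>Z\<in>A. card {u. (u,Z) \<in> C}) \<le> (\<Sum>Z\<in>A. card (U Z))" by (rule sum_mono)
  moreover have "card {(u,Z)\<in>C. card Z = Suc d} = (\<Sum>Z\<in>A. card {u. (u,Z) \<in> C})"
  proof -
    have "bij_betw (\<lambda>(Z,u). (u,Z)) (SIGMA Z:A. {u. (u,Z) \<in> C}) {(u,Z)\<in>C. card Z = Suc d}"
      by (rule bij_betwI[where g = "\<lambda>(u,Z). (Z,u)"]) (auto simp: A_def)
    then have "card (SIGMA Z:A. {u. (u,Z) \<in> C}) = card {(u,Z)\<in>C. card Z = Suc d}" by (rule bij_betw_same_card)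
    then show ?thesis using finC by simp
  qed
  ultimately have "(\<Sum>i<card {(u,Z)\<in>C. card Z = Suc d}. cone_count d m i) \<le>
      (\<Sum>i<(\<Sum>Z\<in>A. card (U Z)). cone_count d m i)"
    by (intro sum_mono2) auto
  also have "\<dots> \<le> card (level m (\<Union>Z\<in>A. \<Union>w\<in>U Z. cone w Z))"
    by (rule card_level_cones_ge) (use UZ in \<open>auto simp: A_def\<close>)
  also have "\<dots> \<le> card (level m X)"
    by (rule card_mono[OF finite_level level_mono]) (use sub in blast)
  finally show ?thesis .
qed

section \<open>The bound as a sum, and the Hilbert polynomial of a union of cones\<close>

lemma binom_of_nat: "binom (real n) k = real (n choose k)"
  by (simp add: binom_def binomial_gbinomial)

text \<open>Pascal's rule, telescoped over \<open>D\<close>. Once \<open>D > m\<close> nothing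
  changes any more: the new summand is \<open>0\<close>, and the subtracted binomial has top at most
  \<open>d\<close>, possibly negative, so it is \<open>0\<close> as well.\<close>

lemma binom_diff_eq_sum:
  "binom (real m + real d + 1) (d + 1) - binom (real m - real D + real d + 1) (d + 1)
    = real (\<Sum>i<D. cone_count d m i)"
proof (induction D)
  case 0
  show ?case by simp
next
  case (Suc D)
  have "binom (real m - real D + real d + 1) (d + 1)
      = binom (real m - real (Suc D) + real d + 1) (d + 1) + real (cone_count d m D)"
  proof (cases "D \<le> m")
    case True
    then have "real m - real D + real d + 1 = real (Suc (m - D + d))"
      "real m - real (Suc D) + real d + 1 = real (m - D + d)" by (simp_all add: of_nat_diff)
    then show ?thesis using True by (simp only: binom_of_nat) (simp add: cone_count_def)
  next
    case False
    have vanish: "binom (real m - real k + real d + 1) (d + 1) = 0" if "k > m" for k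
    proof (cases "k \<le> m + d + 1")
      case True
      then have "real m - real k + real d + 1 = real (m + d + 1 - k)" by (simp add: of_nat_diff)
      then show ?thesis using that by (simp only: binom_of_nat) simp
    next
      case False
      then show ?thesis by (simp add: binom_def)
    qed
    have "cone_count d m D = 0" using False by (simp add: cone_count_def)
    then show ?thesis using vanish[of D] vanish[of "Suc D"] False by (simp only: of_nat_0 add_0_right)
  qed
  then show ?case using Suc.IH by simp
qed

text \<open>The polynomial \<open>(t - s + c) choose c\<close> in \<open>t\<close>, written as
  \<open>c\<close> monic linear factors over \<open>c!\<close> so that its degree and leading
  coefficient can be read off.\<close>

definition cone_poly :: "nat \<Rightarrow> nat \<Rightarrow> real poly" where
  "cone_poly c s = smult (1 / fact c) (\<Prod>i<c. [:real c - real s - real i, 1:])"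

lemma poly_cone_poly:
  assumes "s \<le> m"
  shows "poly (cone_poly c s) (real m) = real ((m - s + c) choose c)"
proof -
  have "real ((m - s + c) choose c) = (real m - real s + real c) gchoose c"
    using assms by (simp add: binomial_gbinomial algebra_simps)
  also have "\<dots> = (\<Prod>i<c. real m - real s + real c - real i) / fact c"
    by (simp add: gbinomial_prod_rev lessThan_atLeast0)
  finally show ?thesis
    by (simp add: cone_poly_def poly_prod algebra_simps)
qed

lemma degree_prod_linear: "degree (\<Prod>i<c. [:a i, 1:] :: real poly) = c"
  by (subst degree_prod_eq_sum_degree) auto

lemma coeff_cone_poly:
  "coeff (cone_poly c s) c = 1 / fact c"
  "c < d \<Longrightarrow> coeff (cone_poly c s) d = 0"
proof -
  have "coeff (\<Prod>i<c. [:a i, 1:]) c = (1::real)" for a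
    using lead_coeff_prod[of "\<lambda>i. [:a i, 1:] :: real poly" "{..<c}"] by (simp add: degree_prod_linear)
  then show "coeff (cone_poly c s) c = 1 / fact c" by (simp add: cone_poly_def)
  show "coeff (cone_poly c s) d = 0" if "c < d"
    using that by (intro coeff_eq_0) (simp add: cone_poly_def degree_prod_linear)
qed

text \<open>Beyond all apexes a cone with nonempty \<open>Z\<close> contributes a polynomial of
  degree \<open>card Z - 1\<close> with leading coefficient \<open>1 / fact (card Z - 1)\<close>,
  and a single point contributes \<open>0\<close>. Since \<open>card Z \<le> d + 1\<close>, the
  coefficient at \<open>d\<close> counts the cones of dimension \<open>d + 1\<close>.\<close>

lemma downset_hilbert_poly:
  fixes X :: "('v::finite \<Rightarrow> nat) set"
  assumes "finite C" and C: "X = (\<Union>(u,Z)\<in>C. cone u Z)" "disjoint_family_on (\<lambda>(u,Z). cone u Z) C"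
    and dim: "\<And>u Z. (u,Z) \<in> C \<Longrightarrow> card Z \<le> Suc d"
  obtains p :: "real poly"
  where "\<forall>\<^sub>F m in sequentially. real (card (level m X)) = poly p (real m)"
    and "fact d * coeff p d = real (card {(u,Z)\<in>C. card Z = Suc d})"
proof -
  define q where "q = (\<lambda>(u :: 'v \<Rightarrow> nat, Z :: 'v set). if Z = {} then 0 else cone_poly (card Z - 1) (fdeg u))"
  \<comment> \<open>The inequality is strict because of \<open>Z = {}\<close>: in degree
    \<open>fdeg u\<close> the point \<open>u\<close> itself is still counted.\<close>
  have q: "real (card (level m (cone u Z))) = poly (q (u,Z)) (real m)" if "fdeg u < m" for m u Z
  proof (cases "Z = {}")
    case True
    then show ?thesis using that by (simp add: q_def card_level_cone_empty)
  next
    case False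
    then have "card Z = Suc (card Z - 1)" using card_gt_0_iff[of Z] by auto
    then show ?thesis using that False card_level_cone_Suc[of Z "card Z - 1" m u]
      by (simp add: q_def poly_cone_poly)
  qed
  have coeff_q: "fact d * coeff (q x) d = (if card (snd x) = Suc d then 1 else 0)" if "x \<in> C" for x
  proof -
    obtain u Z where x: "x = (u,Z)" by (cases x)
    have "card Z \<le> Suc d" using dim that x by blast
    show ?thesis
    proof (cases "Z = {}")
      case True
      then show ?thesis by (simp add: x q_def)
    next
      case False
      then have "card Z > 0" by (simp add: card_gt_0_iff)
      show ?thesis
      proof (cases "card Z = Suc d")
        case True
        then show ?thesis using False coeff_cone_poly(1)[of d] by (simp add: x q_def)
      next
        case neq: False
        then have "card Z - 1 < d" using \<open>card Z > 0\<close> \<open>card Z \<le> Suc d\<close> by simp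
        then show ?thesis using False neq coeff_cone_poly(2) by (simp add: x q_def)
      qed
    qed
  qed
  show ?thesis
  proof (rule that[of "\<Sum>x\<in>C. q x"])
    \<comment> \<open>The sum of the apex degrees is a crude common bound for all of them.\<close>
    define M where "M = (\<Sum>x\<in>C. fdeg (fst x))"
    have M: "fdeg u \<le> M" if "(u,Z) \<in> C" for u Z
      using member_le_sum[of "(u,Z)" C "\<lambda>x. fdeg (fst x)"] that assms(1) by (simp add: M_def)
    have "real (card (level m X)) = poly (\<Sum>x\<in>C. q x) (real m)" if "m > M" for m
    proof -
      have "level m X = (\<Union>x\<in>C. level m (case x of (u,Z) \<Rightarrow> cone u Z))"
        unfolding C(1) level_def by auto
      also have "card \<dots> = (\<Sum>x\<in>C. card (level m (case x of (u,Z) \<Rightarrow> cone u Z)))"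
      proof (rule card_UN_disjoint)
        show "\<forall>x\<in>C. \<forall>y\<in>C. x \<noteq> y \<longrightarrow> level m (case x of (u,Z) \<Rightarrow> cone u Z) \<inter> level m (case y of (u,Z) \<Rightarrow> cone u Z) = {}"
          using C(2) unfolding disjoint_family_on_def level_def by blast
      qed (use assms(1) in simp_all)
      finally have "real (card (level m X)) = (\<Sum>x\<in>C. real (card (level m (case x of (u,Z) \<Rightarrow> cone u Z))))"
        by simp
      also have "\<dots> = (\<Sum>x\<in>C. poly (q x) (real m))"
      proof (rule sum.cong[OF refl])
        fix x assume x: "x \<in> C"
        obtain u Z where uZ: "x = (u,Z)" by (cases x)
        have "fdeg u < m" using M[of u Z] x uZ that by simp
        then show "real (card (level m (case x of (u,Z) \<Rightarrow> cone u Z))) = poly (q x) (real m)"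
          using q[of u m Z] uZ by simp
      qed
      finally show ?thesis by (simp add: poly_sum)
    qed
    then show "\<forall>\<^sub>F m in sequentially. real (card (level m X)) = poly (\<Sum>x\<in>C. q x) (real m)"
      by (metis (mono_tags, lifting) eventually_sequentiallyI Suc_le_lessD)
    have "fact d * coeff (\<Sum>x\<in>C. q x) d = (\<Sum>x\<in>C. fact d * coeff (q x) d)"
      by (simp add: coeff_sum sum_distrib_left)
    also have "\<dots> = (\<Sum>x\<in>C. if card (snd x) = Suc d then 1 else 0)"
      by (rule sum.cong) (simp_all add: coeff_q)
    also have "\<dots> = real (card {x\<in>C. card (snd x) = Suc d})"
      using assms(1) by (simp add: sum.If_cases Int_def)
    also have "{x\<in>C. card (snd x) = Suc d} = {(u,Z)\<in>C. card Z = Suc d}" by auto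
    finally show "fact d * coeff (\<Sum>x\<in>C. q x) d = real (card {(u,Z)\<in>C. card Z = Suc d})" .
  qed
qed

subsection \<open>Leading monomials\<close>

abbreviation lookup :: "('a \<Rightarrow>\<^sub>0 'b::zero) \<Rightarrow> 'a \<Rightarrow> 'b" where "lookup \<equiv> Poly_Mapping.lookup"
abbreviation keys :: "('a \<Rightarrow>\<^sub>0 'b::zero) \<Rightarrow> 'a set" where "keys \<equiv> Poly_Mapping.keys"

definition var_index :: "'v::finite \<Rightarrow> nat" where
  "var_index = (SOME f. inj f)"

lemma inj_var_index: "inj (var_index :: 'v::finite \<Rightarrow> nat)"
proof -
  obtain f :: "'v \<Rightarrow> nat" where "inj f" using finite_imp_inj_to_nat_seg[of "UNIV :: 'v set"] by auto
  then show ?thesis unfolding var_index_def by (rule someI[of "\<lambda>f. inj f"])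
qed

text \<open>The variables carry no order, so monomials are compared by the lexicographic order on
  \<open>nat \<Rightarrow>\<^sub>0 nat\<close> after numbering the variables.\<close>

definition mon_key :: "('v::finite \<Rightarrow>\<^sub>0 nat) \<Rightarrow> (nat \<Rightarrow>\<^sub>0 nat)" where
  "mon_key \<alpha> = (\<Sum>v\<in>UNIV. Poly_Mapping.single (var_index v) (lookup \<alpha> v))"

text \<open>Additivity is what makes leading monomials compatible with multiplication by a
  monomial.\<close>

lemma mon_key_add: "mon_key (\<alpha> + \<beta>) = mon_key \<alpha> + mon_key \<beta>"
  by (simp add: mon_key_def lookup_add single_add sum.distrib)

lemma lookup_mon_key: "lookup (mon_key \<alpha>) (var_index v) = lookup \<alpha> v"
proof -
  have "lookup (mon_key \<alpha>) (var_index v) = (\<Sum>w\<in>UNIV. if w = v then lookup \<alpha> w else 0)"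
    unfolding mon_key_def lookup_sum
    by (rule sum.cong) (use inj_var_index in \<open>auto simp: lookup_single when_def dest: injD\<close>)
  then show ?thesis by simp
qed

lemma mon_key_inject [simp]: "mon_key \<alpha> = mon_key \<beta> \<longleftrightarrow> \<alpha> = \<beta>"
  by (metis lookup_mon_key poly_mapping_eqI)

definition is_lead :: "('v::finite, 'k::field) mpoly \<Rightarrow> ('v \<Rightarrow>\<^sub>0 nat) \<Rightarrow> bool" where
  "is_lead f \<alpha> \<longleftrightarrow> \<alpha> \<in> keys f \<and> (\<forall>\<beta>\<in>keys f. mon_key \<beta> \<le> mon_key \<alpha>)"

lemma lead_exists:
  assumes "f \<noteq> 0"
  obtains \<alpha> where "is_lead f \<alpha>"
proof -
  have "keys f \<noteq> {}" using assms by (simp add: keys_eq_empty)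
  then have "Max (mon_key ` keys f) \<in> mon_key ` keys f" by simp
  then obtain \<alpha> where "\<alpha> \<in> keys f" "mon_key \<alpha> = Max (mon_key ` keys f)" by auto
  then have "is_lead f \<alpha>" by (simp add: is_lead_def)
  then show ?thesis by (rule that)
qed

lemma lookup_single_mult:
  fixes f :: "('v::finite, 'k::field) mpoly"
  shows "lookup (Poly_Mapping.single \<alpha> c * f) (\<alpha> + \<beta>) = c * lookup f \<beta>"
proof -
  have "lookup (Poly_Mapping.single \<alpha> c * f) (\<alpha> + \<beta>)
      = (\<Sum>l. (c when \<alpha> = l) * (\<Sum>q. lookup f q when \<alpha> + \<beta> = l + q))"
    by (simp add: lookup_mult lookup_single)
  also have "\<dots> = (\<Sum>l. (c * (\<Sum>q. lookup f q when \<alpha> + \<beta> = l + q)) when \<alpha> = l)"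
    by (simp add: when_mult)
  also have "\<dots> = c * (\<Sum>q. lookup f q when \<alpha> + \<beta> = \<alpha> + q)"
    by simp
  also have "\<dots> = c * lookup f \<beta>" by simp
  finally show ?thesis .
qed

lemma keys_single_mult:
  fixes f :: "('v::finite, 'k::field) mpoly"
  assumes "c \<noteq> 0"
  shows "keys (Poly_Mapping.single \<alpha> c * f) = (\<lambda>\<beta>. \<alpha> + \<beta>) ` keys f"
proof
  show "keys (Poly_Mapping.single \<alpha> c * f) \<subseteq> (\<lambda>\<beta>. \<alpha> + \<beta>) ` keys f"
    using keys_mult[of "Poly_Mapping.single \<alpha> c" f] by (auto split: if_splits)
  show "(\<lambda>\<beta>. \<alpha> + \<beta>) ` keys f \<subseteq> keys (Poly_Mapping.single \<alpha> c * f)"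
    using assms by (auto simp: in_keys_iff lookup_single_mult)
qed

lemma is_lead_single_mult:
  assumes "is_lead f \<beta>" "c \<noteq> 0"
  shows "is_lead (Poly_Mapping.single \<alpha> c * f) (\<alpha> + \<beta>)"
  using assms unfolding is_lead_def keys_single_mult[OF assms(2)] by (auto simp: mon_key_add)

section \<open>Polynomials as a vector space\<close>

text \<open>Scaling is multiplication by a constant polynomial, so the vector space axioms and the
  compatibility with products follow from the ring laws.\<close>

lemma mscale_eq: "mscale c f = Poly_Mapping.single 0 c * f"
  unfolding mscale_def by (rule mult_map_scale_conv_mult)

lemma lookup_mscale: "lookup (mscale c f) \<alpha> = c * lookup f \<alpha>" for f :: "('v::finite, 'k::field) mpoly"
  using lookup_single_mult[of 0 c f \<alpha>] by (simp add: mscale_eq)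

lemma keys_mscale: "keys (mscale c f) \<subseteq> keys f" for f :: "('v::finite, 'k::field) mpoly"
  by (auto simp: in_keys_iff lookup_mscale)

interpretation mpoly: vector_space "mscale :: 'k::field \<Rightarrow> ('v::finite, 'k) mpoly \<Rightarrow> ('v, 'k) mpoly"
  by unfold_locales (simp_all add: mscale_eq algebra_simps single_add mult_single flip: mult.assoc)

lemma mscale_mult: "mscale c f * g = mscale c (f * g)" for f :: "('v::finite, 'k::field) mpoly"
  by (simp add: mscale_eq mult.assoc)

text \<open>The span of a set \<open>A\<close> of monomials. With \<open>A\<close> the monomials of
  degree \<open>m\<close>, or those of degree at most \<open>m\<close>, the same linear algebra
  serves the graded and the affine Hilbert function.\<close>

definition supp_in :: "('v::finite \<Rightarrow>\<^sub>0 nat) set \<Rightarrow> ('v, 'k::field) mpoly set" where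
  "supp_in A = {f. keys f \<subseteq> A}"

lemma subspace_supp_in: "mpoly.subspace (supp_in A)"
proof (rule mpoly.subspaceI)
  show "0 \<in> supp_in A" by (simp add: supp_in_def)
  show "f + g \<in> supp_in A" if "f \<in> supp_in A" "g \<in> supp_in A" for f g
    using that keys_add[of f g] unfolding supp_in_def by blast
  show "mscale c f \<in> supp_in A" if "f \<in> supp_in A" for c f
    using that keys_mscale[of c f] unfolding supp_in_def by blast
qed

lemma supp_in_single [simp]: "\<alpha> \<in> A \<Longrightarrow> Poly_Mapping.single \<alpha> c \<in> supp_in A"
  by (simp add: supp_in_def)

section \<open>Standard monomials, reduction and dimension\<close>

text \<open>Standard monomials in the sense of Groebner bases, but relative to a window
  \<open>A\<close>: only elements supported in \<open>A\<close> compete for leading monomials, so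
  for finite \<open>A\<close> everything takes place in finite dimension.\<close>

definition std_mons :: "('v::finite, 'k::field) mpoly set \<Rightarrow> ('v \<Rightarrow>\<^sub>0 nat) set \<Rightarrow> ('v \<Rightarrow>\<^sub>0 nat) set" where
  "std_mons V A = {\<alpha>\<in>A. \<not> (\<exists>f\<in>V \<inter> supp_in A. is_lead f \<alpha>)}"

lemma std_mons_subset: "std_mons V A \<subseteq> A"
  by (auto simp: std_mons_def)

lemma supp_in_std_mons_Int:
  assumes "f \<in> V" "f \<in> supp_in (std_mons V A)"
  shows "f = 0"
proof (rule ccontr)
  assume "f \<noteq> 0"
  then obtain \<alpha> where "is_lead f \<alpha>" by (rule lead_exists)
  moreover have "f \<in> supp_in A" using assms(2) std_mons_subset by (fastforce simp: supp_in_def)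
  moreover have "\<alpha> \<in> std_mons V A" using \<open>is_lead f \<alpha>\<close> assms(2) by (auto simp: is_lead_def supp_in_def)
  ultimately show False using assms(1) by (auto simp: std_mons_def)
qed

text \<open>Division with remainder by linear algebra alone. A leading term at a standard monomial
  is moved into the remainder; any other is cancelled by a scalar multiple of an element of
  \<open>V\<close>. The number of monomials of \<open>A\<close> up to the leading one
  decreases.\<close>

lemma std_mons_reduction:
  fixes V :: "('v::finite, 'k::field) mpoly set"
  assumes "finite A" and V: "mpoly.subspace V" and "f \<in> supp_in A"
  shows "\<exists>w\<in>supp_in (std_mons V A). f - w \<in> V \<inter> supp_in A"
  using assms(3)
proof (induction "card {\<gamma>\<in>A. \<exists>\<beta>\<in>keys f. mon_key \<gamma> \<le> mon_key \<beta>}" arbitrary: f rule: less_induct)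
  case less
  show ?case
  proof (cases "f = 0")
    case True
    then show ?thesis using mpoly.subspace_0[OF V] mpoly.subspace_0[OF subspace_supp_in]
      by (intro bexI[of _ 0]) (simp_all add: supp_in_def)
  next
    case False
    then obtain \<alpha> where \<alpha>: "is_lead f \<alpha>" by (rule lead_exists)
    then have "\<alpha> \<in> A" using less.prems by (auto simp: is_lead_def supp_in_def)
    \<comment> \<open>Common to both cases: subtracting any \<open>g\<close> with the same leading
      term as \<open>f\<close> lowers the measure.\<close>
    have step: "\<exists>w\<in>supp_in (std_mons V A). (f - g) - w \<in> V \<inter> supp_in A"
      if g: "is_lead g \<alpha>" "lookup g \<alpha> = lookup f \<alpha>" "g \<in> supp_in A" for g
    proof (rule less.hyps)
      show fg: "f - g \<in> supp_in A" using less.prems g(3) by (rule mpoly.subspace_diff[OF subspace_supp_in])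
      have below: "mon_key \<beta> < mon_key \<alpha>" if "\<beta> \<in> keys (f - g)" for \<beta>
      proof -
        have "\<beta> \<in> keys f \<union> keys g" using that keys_diff[of f g] by blast
        then have "mon_key \<beta> \<le> mon_key \<alpha>" using \<alpha> g(1) by (auto simp: is_lead_def)
        moreover have "\<beta> \<noteq> \<alpha>" using that g(2) by (auto simp: in_keys_iff lookup_minus)
        ultimately show ?thesis by (simp add: less_le)
      qed
      show "card {\<gamma>\<in>A. \<exists>\<beta>\<in>keys (f - g). mon_key \<gamma> \<le> mon_key \<beta>}
          < card {\<gamma>\<in>A. \<exists>\<beta>\<in>keys f. mon_key \<gamma> \<le> mon_key \<beta>}"
      proof (rule psubset_card_mono)
        show "finite {\<gamma>\<in>A. \<exists>\<beta>\<in>keys f. mon_key \<gamma> \<le> mon_key \<beta>}" using assms(1) by simp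
        have sub: "{\<gamma>\<in>A. \<exists>\<beta>\<in>keys (f - g). mon_key \<gamma> \<le> mon_key \<beta>} \<subseteq> {\<gamma>\<in>A. \<exists>\<beta>\<in>keys f. mon_key \<gamma> \<le> mon_key \<beta>}"
          using below \<alpha> unfolding is_lead_def by (smt (verit) Collect_mono less_imp_le order_trans)
        have "\<alpha> \<notin> {\<gamma>\<in>A. \<exists>\<beta>\<in>keys (f - g). mon_key \<gamma> \<le> mon_key \<beta>}" using below by force
        moreover have "\<alpha> \<in> {\<gamma>\<in>A. \<exists>\<beta>\<in>keys f. mon_key \<gamma> \<le> mon_key \<beta>}"
          using \<open>\<alpha> \<in> A\<close> \<alpha> by (auto simp: is_lead_def)
        ultimately show "{\<gamma>\<in>A. \<exists>\<beta>\<in>keys (f - g). mon_key \<gamma> \<le> mon_key \<beta>}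
            \<subset> {\<gamma>\<in>A. \<exists>\<beta>\<in>keys f. mon_key \<gamma> \<le> mon_key \<beta>}" using sub by blast
      qed
    qed
    have f\<alpha>: "lookup f \<alpha> \<noteq> 0" using \<alpha> by (simp add: is_lead_def in_keys_iff)
    show ?thesis
    proof (cases "\<alpha> \<in> std_mons V A")
      case True
      let ?m = "Poly_Mapping.single \<alpha> (lookup f \<alpha>)"
      have "\<exists>w\<in>supp_in (std_mons V A). (f - ?m) - w \<in> V \<inter> supp_in A"
        by (rule step) (use f\<alpha> \<open>\<alpha> \<in> A\<close> in \<open>auto simp: is_lead_def\<close>)
      then obtain w where w: "w \<in> supp_in (std_mons V A)" "(f - ?m) - w \<in> V \<inter> supp_in A" by blast
      have "?m + w \<in> supp_in (std_mons V A)"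
        using True w(1) by (intro mpoly.subspace_add[OF subspace_supp_in]) simp_all
      moreover have "f - (?m + w) \<in> V \<inter> supp_in A" using w(2) by (simp add: algebra_simps)
      ultimately show ?thesis by blast
    next
      case False
      then obtain v where v: "v \<in> V \<inter> supp_in A" "is_lead v \<alpha>" using \<open>\<alpha> \<in> A\<close> by (auto simp: std_mons_def)
      define g where "g = mscale (lookup f \<alpha> / lookup v \<alpha>) v"
      have v\<alpha>: "lookup v \<alpha> \<noteq> 0" using v(2) by (simp add: is_lead_def in_keys_iff)
      have sub: "mpoly.subspace (V \<inter> supp_in A)" by (rule mpoly.subspace_inter[OF V subspace_supp_in])
      have g: "g \<in> V \<inter> supp_in A" unfolding g_def by (rule mpoly.subspace_scale[OF sub v(1)])
      have "is_lead g \<alpha>" using v(2) v\<alpha> f\<alpha> unfolding is_lead_def g_def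
        by (auto simp: in_keys_iff lookup_mscale)
      moreover have "lookup g \<alpha> = lookup f \<alpha>" using v\<alpha> by (simp add: g_def lookup_mscale)
      ultimately obtain w where w: "w \<in> supp_in (std_mons V A)" "(f - g) - w \<in> V \<inter> supp_in A"
        using step g by blast
      have "f - w = ((f - g) - w) + g" by simp
      also have "\<dots> \<in> V \<inter> supp_in A" by (rule mpoly.subspace_add[OF sub w(2) g])
      finally show ?thesis using w(1) by blast
    qed
  qed
qed

text \<open>The remainder of \<open>f\<close> modulo \<open>V\<close> lies in \<open>W\<close> and
  involves only monomials that are standard for \<open>W\<close>, hence it is zero.\<close>

lemma subspace_eqI_std_mons:
  fixes V W :: "('v::finite, 'k::field) mpoly set"
  assumes "finite A" "mpoly.subspace V" "mpoly.subspace W" "V \<subseteq> W" "std_mons V A \<subseteq> std_mons W A"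
  shows "W \<inter> supp_in A \<subseteq> V"
proof
  fix f assume f: "f \<in> W \<inter> supp_in A"
  then obtain w where w: "w \<in> supp_in (std_mons V A)" "f - w \<in> V \<inter> supp_in A"
    using std_mons_reduction[OF assms(1,2), of f] by blast
  have "f - (f - w) \<in> W"
    by (rule mpoly.subspace_diff[OF assms(3)]) (use f w(2) assms(4) in auto)
  then have "w = 0" using w(1) assms(5) by (intro supp_in_std_mons_Int[of w W A]) (auto simp: supp_in_def)
  then show "f \<in> V" using w(2) by simp
qed

lemma span_monomials:
  assumes "finite A"
  shows "(supp_in A :: ('v::finite, 'k::field) mpoly set) \<subseteq> mpoly.span ((\<lambda>\<alpha>. Poly_Mapping.single \<alpha> 1) ` A)"
proof
  fix f :: "('v, 'k) mpoly" assume "f \<in> supp_in A"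
  then have eq: "f = (\<Sum>\<alpha>\<in>A. mscale (lookup f \<alpha>) (Poly_Mapping.single \<alpha> 1))"
    using assms by (intro poly_mapping_eqI)
      (auto simp: lookup_sum lookup_mscale lookup_single when_def supp_in_def in_keys_iff subset_iff
        if_distrib[where f = "(*) c" for c] cong: if_cong)
  show "f \<in> mpoly.span ((\<lambda>\<alpha>. Poly_Mapping.single \<alpha> 1) ` A)"
    by (subst eq) (intro mpoly.span_sum mpoly.span_scale mpoly.span_base imageI)
qed

lemma finite_independent_supp_in:
  fixes B :: "('v::finite, 'k::field) mpoly set"
  assumes "finite A" "mpoly.independent B" "B \<subseteq> supp_in A"
  shows "finite B"
proof -
  have "B \<subseteq> mpoly.span ((\<lambda>\<alpha>. Poly_Mapping.single \<alpha> 1) ` A)"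
    using assms(3) span_monomials[OF assms(1)] by (rule subset_trans)
  then show ?thesis
    using mpoly.independent_span_bound[OF finite_imageI[OF assms(1)] assms(2)] by simp
qed

text \<open>In a vanishing combination consider the largest lead \<alpha> with nonzero coefficient:
  no other member that occurs involves the monomial \<alpha>.\<close>

lemma independent_leads:
  fixes F :: "('v::finite \<Rightarrow>\<^sub>0 nat) \<Rightarrow> ('v, 'k::field) mpoly"
  assumes "finite A" "\<And>\<alpha>. \<alpha> \<in> A \<Longrightarrow> is_lead (F \<alpha>) \<alpha>"
  shows "mpoly.independent (F ` A)" "inj_on F A"
proof -
  show inj: "inj_on F A"
  proof (rule inj_onI)
    fix \<alpha> \<beta> assume "\<alpha> \<in> A" "\<beta> \<in> A" "F \<alpha> = F \<beta>"
    then have "is_lead (F \<alpha>) \<alpha>" "is_lead (F \<alpha>) \<beta>" using assms(2)[of \<alpha>] assms(2)[of \<beta>] by simp_all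
    then have "mon_key \<beta> \<le> mon_key \<alpha>" "mon_key \<alpha> \<le> mon_key \<beta>" by (auto simp only: is_lead_def)
    then have "mon_key \<alpha> = mon_key \<beta>" by (rule antisym[rotated])
    then show "\<alpha> = \<beta>" by simp
  qed
  show "mpoly.independent (F ` A)"
  proof (rule mpoly.independent_if_scalars_zero)
    show "finite (F ` A)" using assms(1) by simp
    fix c x assume sum: "(\<Sum>x\<in>F ` A. mscale (c x) x) = 0" and x: "x \<in> F ` A"
    show "c x = 0"
    proof (rule ccontr)
      assume "c x \<noteq> 0"
      define B where "B = {\<alpha>\<in>A. c (F \<alpha>) \<noteq> 0}"
      have B: "finite B" "B \<noteq> {}" using assms(1) x \<open>c x \<noteq> 0\<close> by (auto simp: B_def)
      then have "Max (mon_key ` B) \<in> mon_key ` B" by simp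
      then obtain \<alpha> where \<alpha>: "\<alpha> \<in> B" "mon_key \<alpha> = Max (mon_key ` B)" by auto
      have "0 = lookup (\<Sum>x\<in>F ` A. mscale (c x) x) \<alpha>" using sum by simp
      also have "\<dots> = (\<Sum>\<beta>\<in>A. c (F \<beta>) * lookup (F \<beta>) \<alpha>)"
        by (simp add: lookup_sum lookup_mscale sum.reindex[OF inj])
      also have "\<dots> = (\<Sum>\<beta>\<in>A. if \<beta> = \<alpha> then c (F \<alpha>) * lookup (F \<alpha>) \<alpha> else 0)"
      proof (rule sum.cong[OF refl])
        fix \<beta> assume \<beta>: "\<beta> \<in> A"
        have "c (F \<beta>) * lookup (F \<beta>) \<alpha> = 0" if "\<beta> \<noteq> \<alpha>"
        proof (rule ccontr)
          assume "c (F \<beta>) * lookup (F \<beta>) \<alpha> \<noteq> 0"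
          then have "\<beta> \<in> B" "\<alpha> \<in> keys (F \<beta>)" using \<beta> by (auto simp: B_def in_keys_iff)
          then have "mon_key \<alpha> \<le> mon_key \<beta>" "mon_key \<beta> \<le> mon_key \<alpha>"
            using assms(2)[OF \<beta>] \<alpha>(2) B(1) by (auto simp: is_lead_def)
          then have "mon_key \<alpha> = mon_key \<beta>" by (rule antisym)
          then show False using that by simp
        qed
        then show "c (F \<beta>) * lookup (F \<beta>) \<alpha> = (if \<beta> = \<alpha> then c (F \<alpha>) * lookup (F \<alpha>) \<alpha> else 0)" by auto
      qed
      also have "\<dots> = c (F \<alpha>) * lookup (F \<alpha>) \<alpha>" using assms(1) \<alpha>(1) by (simp add: B_def)
      finally show False using \<alpha>(1) assms(2)[of \<alpha>] by (auto simp: B_def is_lead_def in_keys_iff)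
    qed
  qed
qed

text \<open>Choosing one element of \<open>V\<close> for each leading monomial gives an independent
  family. Its span has no standard monomials beyond those of \<open>V\<close>, so it is
  everything.\<close>

lemma dim_supp_in_Int:
  fixes V :: "('v::finite, 'k::field) mpoly set"
  assumes "finite A" "mpoly.subspace V"
  shows "mpoly.dim (V \<inter> supp_in A) = card A - card (std_mons V A)"
proof -
  let ?L = "A - std_mons V A"
  have "\<forall>\<alpha>\<in>?L. \<exists>f. f \<in> V \<inter> supp_in A \<and> is_lead f \<alpha>" by (auto simp: std_mons_def)
  then obtain F where F: "\<And>\<alpha>. \<alpha> \<in> ?L \<Longrightarrow> F \<alpha> \<in> V \<inter> supp_in A \<and> is_lead (F \<alpha>) \<alpha>" by metis
  have fin: "finite ?L" using assms(1) by simp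
  have ind: "mpoly.independent (F ` ?L)" "inj_on F ?L"
    using independent_leads[OF fin, of F] F by blast+
  have sub: "mpoly.subspace (V \<inter> supp_in A)" by (rule mpoly.subspace_inter[OF assms(2) subspace_supp_in])
  have FV: "mpoly.span (F ` ?L) \<subseteq> V \<inter> supp_in A"
    by (rule mpoly.span_minimal[OF _ sub]) (use F in blast)
  have "V \<inter> supp_in A \<subseteq> mpoly.span (F ` ?L)"
  proof (rule subspace_eqI_std_mons[OF assms(1) mpoly.subspace_span assms(2)])
    show "mpoly.span (F ` ?L) \<subseteq> V" using FV by blast
    show "std_mons (mpoly.span (F ` ?L)) A \<subseteq> std_mons V A"
    proof
      fix \<alpha> assume \<alpha>: "\<alpha> \<in> std_mons (mpoly.span (F ` ?L)) A"
      then have "\<alpha> \<in> A" using std_mons_subset by blast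
      moreover have "\<alpha> \<notin> ?L"
      proof
        assume L: "\<alpha> \<in> ?L"
        then have "F \<alpha> \<in> mpoly.span (F ` ?L)" by (intro mpoly.span_base imageI)
        then show False using \<alpha> F[OF L] by (auto simp: std_mons_def)
      qed
      ultimately show "\<alpha> \<in> std_mons V A" by blast
    qed
  qed
  then have "mpoly.dim (V \<inter> supp_in A) = card (F ` ?L)"
    using ind(1) F by (intro mpoly.basis_card_eq_dim[symmetric]) auto
  also have "\<dots> = card A - card (std_mons V A)"
    using card_image[OF ind(2)] card_Diff_subset[OF finite_subset[OF std_mons_subset assms(1)] std_mons_subset]
    by simp
  finally show ?thesis .
qed

lemma std_mons_UNIV [simp]: "std_mons (UNIV :: ('v::finite, 'k::field) mpoly set) A = {}"
proof -
  have "is_lead (Poly_Mapping.single \<alpha> (1::'k)) \<alpha>" for \<alpha> :: "'v \<Rightarrow>\<^sub>0 nat" by (simp add: is_lead_def)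
  then show ?thesis by (fastforce simp: std_mons_def)
qed

lemma dim_supp_in:
  assumes "finite A"
  shows "mpoly.dim (supp_in A :: ('v::finite, 'k::field) mpoly set) = card A"
  using dim_supp_in_Int[OF assms, of "UNIV :: ('v, 'k) mpoly set"] by simp

subsection \<open>Graded pieces and Hilbert functions\<close>

lemma mon_deg_eq_fdeg: "mon_deg \<alpha> = fdeg (lookup \<alpha>)"
  by (simp add: mon_deg_def fdeg_def)

lemma mon_deg_add: "mon_deg (\<alpha> + \<beta>) = mon_deg \<alpha> + mon_deg \<beta>"
  by (simp add: mon_deg_def lookup_add sum.distrib)

definition mons_eq :: "nat \<Rightarrow> ('v::finite \<Rightarrow>\<^sub>0 nat) set" where
  "mons_eq m = {\<alpha>. mon_deg \<alpha> = m}"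

definition mons_le :: "nat \<Rightarrow> ('v::finite \<Rightarrow>\<^sub>0 nat) set" where
  "mons_le m = {\<alpha>. mon_deg \<alpha> \<le> m}"

lemma inj_lookup: "inj_on lookup A"
  by (auto intro!: inj_onI poly_mapping_eqI dest: fun_cong)

lemma finite_mons_le [simp]: "finite (mons_le m)"
proof (rule finite_imageD[OF _ inj_lookup])
  show "finite (lookup ` mons_le m)"
    by (rule finite_subset[OF _ finite_fdeg_le[of m]]) (auto simp: mons_le_def mon_deg_eq_fdeg)
qed

lemma card_mons_le: "card (mons_le m :: ('v::finite \<Rightarrow>\<^sub>0 nat) set) \<le> (m + 1) ^ card (UNIV :: 'v set)"
proof -
  have "card (mons_le m :: ('v \<Rightarrow>\<^sub>0 nat) set) = card (lookup ` (mons_le m :: ('v \<Rightarrow>\<^sub>0 nat) set))"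
    by (rule card_image[symmetric, OF inj_lookup])
  also have "\<dots> \<le> card {f::'v \<Rightarrow> nat. fdeg f \<le> m}"
    by (rule card_mono[OF finite_fdeg_le]) (auto simp: mons_le_def mon_deg_eq_fdeg)
  also have "\<dots> \<le> (m + 1) ^ card (UNIV :: 'v set)" by (rule card_fdeg_le)
  finally show ?thesis .
qed

lemma finite_mons_eq [simp]: "finite (mons_eq m)"
  by (rule finite_subset[OF _ finite_mons_le[of m]]) (auto simp: mons_eq_def mons_le_def)

lemma hom_part_eq: "hom_part m = supp_in (mons_eq m)"
  by (auto simp: hom_part_def supp_in_def mons_eq_def)

lemma is_ideal_0: "is_ideal I \<Longrightarrow> 0 \<in> I"
  and is_ideal_add: "is_ideal I \<Longrightarrow> a \<in> I \<Longrightarrow> b \<in> I \<Longrightarrow> a + b \<in> I"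
  and is_ideal_mult: "is_ideal I \<Longrightarrow> a \<in> I \<Longrightarrow> r * a \<in> I"
  by (simp_all add: is_ideal_def)

lemma subspace_ideal: "is_ideal I \<Longrightarrow> mpoly.subspace I"
  by (rule mpoly.subspaceI) (auto simp: is_ideal_def mscale_eq)

lemma is_ideal_sum: "is_ideal I \<Longrightarrow> (\<And>x. x \<in> A \<Longrightarrow> f x \<in> I) \<Longrightarrow> sum f A \<in> I"
  by (rule mpoly.subspace_sum[OF subspace_ideal])

lemma is_ideal_eq_UNIV: "is_ideal I \<Longrightarrow> 1 \<in> I \<Longrightarrow> I = UNIV"
  using is_ideal_mult[of I 1] by auto

lemma kdim_eq_dim: "kdim V = mpoly.dim V"
  by (simp add: kdim_def)

text \<open>Macaulay's observation that standard monomials count the dimension of the quotient;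
  since they form a subset of the window, the nested natural subtractions are exact.\<close>

lemma hilbert_fun_eq:
  fixes I :: "('v::finite, 'k::field) mpoly set"
  assumes "is_ideal I"
  shows "hilbert_fun I m = card (std_mons I (mons_eq m))"
proof -
  have "card (std_mons I (mons_eq m)) \<le> card (mons_eq m :: ('v \<Rightarrow>\<^sub>0 nat) set)"
    by (rule card_mono[OF finite_mons_eq std_mons_subset])
  then show ?thesis
    unfolding hilbert_fun_def kdim_eq_dim hom_part_eq dim_supp_in[OF finite_mons_eq]
      dim_supp_in_Int[OF finite_mons_eq subspace_ideal[OF assms]] by simp
qed

lemma std_mons_antimono: "V \<subseteq> W \<Longrightarrow> std_mons W A \<subseteq> std_mons V A"
  by (auto simp: std_mons_def)

text \<open>Each monomial is tested only against elements of \<open>I\<close> that are homogeneous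
  of its own degree.\<close>

definition std_set :: "('v::finite, 'k::field) mpoly set \<Rightarrow> ('v \<Rightarrow> nat) set" where
  "std_set I = lookup ` {\<alpha>. \<alpha> \<in> std_mons I (mons_eq (mon_deg \<alpha>))}"

lemma level_std_set: "level m (std_set I) = lookup ` std_mons I (mons_eq m)"
proof -
  have "\<alpha> \<in> std_mons I (mons_eq m) \<Longrightarrow> mon_deg \<alpha> = m" for \<alpha>
    using std_mons_subset by (fastforce simp: mons_eq_def)
  then show ?thesis
    by (auto simp: level_def std_set_def mon_deg_eq_fdeg)
qed

lemma hilbert_fun_eq_card_level:
  "is_ideal I \<Longrightarrow> hilbert_fun I m = card (level m (std_set I))"
  by (simp add: hilbert_fun_eq level_std_set card_image[OF inj_lookup])

lemma supp_in_mult: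
  assumes "f \<in> supp_in A" "g \<in> supp_in B" "\<And>\<alpha> \<beta>. \<alpha> \<in> A \<Longrightarrow> \<beta> \<in> B \<Longrightarrow> \<alpha> + \<beta> \<in> D"
  shows "f * g \<in> supp_in D"
  using keys_mult[of f g] assms by (fastforce simp: supp_in_def)

lemma hom_part_mult: "f \<in> hom_part i \<Longrightarrow> g \<in> hom_part j \<Longrightarrow> f * g \<in> hom_part (i + j)"
  for f g :: "('v::finite, 'k::field) mpoly"
  unfolding hom_part_eq by (rule supp_in_mult) (auto simp: mons_eq_def mon_deg_add)

text \<open>If a divisor of a monomial leads an element of \<open>I\<close>, multiplying that
  element by the complementary monomial shows that the monomial itself is a lead.\<close>

lemma downset_std_set:
  fixes I :: "('v::finite, 'k::field) mpoly set"
  assumes "is_ideal I"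
  shows "downset (std_set I)"
  unfolding downset_def
proof (intro ballI allI impI)
  fix f g assume "f \<in> std_set I" and "g \<le> f"
  then obtain \<alpha> where f: "f = lookup \<alpha>" and \<alpha>: "\<alpha> \<in> std_mons I (mons_eq (mon_deg \<alpha>))"
    by (auto simp: std_set_def)
  define \<beta> where "\<beta> = Abs_poly_mapping g"
  define \<gamma> where "\<gamma> = Abs_poly_mapping (\<lambda>v. f v - g v)"
  have lb: "lookup \<beta> = g" "lookup \<gamma> = (\<lambda>v. f v - g v)" by (simp_all add: \<beta>_def \<gamma>_def)
  have sum: "\<gamma> + \<beta> = \<alpha>"
    using \<open>g \<le> f\<close> by (intro poly_mapping_eqI) (simp add: lookup_add lb le_fun_def f[symmetric])
  have "\<beta> \<in> std_mons I (mons_eq (mon_deg \<beta>))"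
  proof (rule ccontr)
    assume "\<not> ?thesis"
    then obtain h where h: "h \<in> I" "h \<in> supp_in (mons_eq (mon_deg \<beta>))" "is_lead h \<beta>"
      by (auto simp: std_mons_def mons_eq_def)
    let ?h = "Poly_Mapping.single \<gamma> 1 * h"
    have "?h \<in> I" using assms h(1) by (rule is_ideal_mult)
    moreover have "?h \<in> supp_in (mons_eq (mon_deg \<alpha>))"
      by (rule supp_in_mult[OF supp_in_single[of \<gamma> "{\<gamma>}"] h(2)])
        (auto simp: mons_eq_def mon_deg_add simp flip: sum)
    moreover have "is_lead ?h \<alpha>" using is_lead_single_mult[OF h(3), of 1 \<gamma>] sum by simp
    ultimately show False using \<alpha> by (auto simp: std_mons_def)
  qed
  then show "g \<in> std_set I" using lb by (auto simp: std_set_def image_iff intro!: exI[of _ \<beta>])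
qed

section \<open>Homogeneous components and homogeneous primes\<close>

lemma lookup_hom_comp:
  fixes f :: "('v::finite, 'k::field) mpoly"
  shows "lookup (hom_comp j f) \<alpha> = (if mon_deg \<alpha> = j then lookup f \<alpha> else 0)"
proof -
  have "finite {\<alpha>. (if mon_deg \<alpha> = j then lookup f \<alpha> else 0) \<noteq> 0}"
    by (rule finite_subset[OF _ finite_keys[of f]]) (auto simp: in_keys_iff)
  then show ?thesis by (simp add: hom_comp_def)
qed

context
  fixes f g :: "('v::finite, 'k::field) mpoly"
begin

lemma hom_comp_add: "hom_comp j (f + g) = hom_comp j f + hom_comp j g"
  by (rule poly_mapping_eqI) (simp add: lookup_hom_comp lookup_add)

lemma hom_comp_in_hom_part [simp]: "hom_comp j f \<in> hom_part j"
  by (auto simp: hom_part_def in_keys_iff lookup_hom_comp split: if_splits)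

lemma hom_comp_hom_part: "f \<in> hom_part i \<Longrightarrow> hom_comp j f = (if i = j then f else 0)"
  by (rule poly_mapping_eqI) (auto simp: hom_part_def in_keys_iff lookup_hom_comp)

lemma in_supp_mons_le: "\<exists>N. f \<in> supp_in (mons_le N)"
  by (rule exI[of _ "Max (mon_deg ` keys f)"]) (auto simp: supp_in_def mons_le_def)

end

lemma hom_comp_sum: "hom_comp j (sum f A) = (\<Sum>x\<in>A. hom_comp j (f x :: ('v::finite, 'k::field) mpoly))"
  by (rule poly_mapping_eqI) (simp add: lookup_hom_comp lookup_sum)

lemma sum_hom_comp:
  fixes f :: "('v::finite, 'k::field) mpoly"
  assumes "f \<in> supp_in (mons_le N)"
  shows "(\<Sum>i\<le>N. hom_comp i f) = f"
proof (rule poly_mapping_eqI)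
  fix \<alpha>
  have "mon_deg \<alpha> \<le> N" if "lookup f \<alpha> \<noteq> 0"
    using assms that by (auto simp: supp_in_def mons_le_def in_keys_iff)
  then show "lookup (\<Sum>i\<le>N. hom_comp i f) \<alpha> = lookup f \<alpha>"
    by (auto simp: lookup_sum lookup_hom_comp)
qed

lemma supp_in_mons_le_mono: "N \<le> M \<Longrightarrow> f \<in> supp_in (mons_le N) \<Longrightarrow> f \<in> supp_in (mons_le M)"
  by (auto simp: supp_in_def mons_le_def)

lemma hom_comp_mult_hom_part:
  fixes f a :: "('v::finite, 'k::field) mpoly"
  assumes "a \<in> hom_part e"
  shows "hom_comp m (f * a) = (if e \<le> m then hom_comp (m - e) f * a else 0)"
proof -
  obtain N where "f \<in> supp_in (mons_le N)" using in_supp_mons_le by blast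
  \<comment> \<open>The bound is raised to at least \<open>m\<close> so that the index
    \<open>m - e\<close> lies in the range of summation.\<close>
  then have N: "f \<in> supp_in (mons_le (max N m))" by (rule supp_in_mons_le_mono[rotated]) simp
  have "hom_comp m (f * a) = hom_comp m ((\<Sum>i\<le>max N m. hom_comp i f) * a)"
    by (simp only: sum_hom_comp[OF N])
  also have "\<dots> = (\<Sum>i\<le>max N m. hom_comp m (hom_comp i f * a))"
    by (simp add: sum_distrib_right hom_comp_sum)
  also have "\<dots> = (\<Sum>i\<le>max N m. if i + e = m then hom_comp i f * a else 0)"
    by (rule sum.cong[OF refl]) (rule hom_comp_hom_part[OF hom_part_mult[OF hom_comp_in_hom_part assms]])
  also have "\<dots> = (\<Sum>i\<le>max N m. if i = m - e then (if e \<le> m then hom_comp (m - e) f * a else 0) else 0)"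
    by (rule sum.cong) auto
  also have "\<dots> = (if e \<le> m then hom_comp (m - e) f * a else 0)"
    by (simp add: le_max_iff_disj)
  finally show ?thesis .
qed

lemma hom_comp_mult:
  fixes f g :: "('v::finite, 'k::field) mpoly"
  shows "hom_comp n (f * g) = (\<Sum>i\<le>n. hom_comp i f * hom_comp (n - i) g)"
proof -
  obtain N where "f \<in> supp_in (mons_le N)" using in_supp_mons_le by blast
  then have N: "f \<in> supp_in (mons_le (max N n))" by (rule supp_in_mons_le_mono[rotated]) simp
  have "hom_comp n (f * g) = hom_comp n ((\<Sum>i\<le>max N n. hom_comp i f) * g)"
    by (simp only: sum_hom_comp[OF N])
  also have "\<dots> = (\<Sum>i\<le>max N n. hom_comp n (g * hom_comp i f))"
    by (simp add: sum_distrib_left hom_comp_sum mult.commute[of _ g])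
  also have "\<dots> = (\<Sum>i\<le>max N n. if i \<le> n then hom_comp i f * hom_comp (n - i) g else 0)"
    by (rule sum.cong[OF refl])
      (simp add: hom_comp_mult_hom_part[OF hom_comp_in_hom_part] mult.commute)
  also have "\<dots> = (\<Sum>i\<le>n. hom_comp i f * hom_comp (n - i) g)"
    by (rule sum.mono_neutral_cong_right) auto
  finally show ?thesis .
qed

lemma hom_ideal_memI:
  fixes J :: "('v::finite, 'k::field) mpoly set"
  assumes "is_ideal J" "\<And>j. hom_comp j f \<in> J"
  shows "f \<in> J"
proof -
  obtain N where "f \<in> supp_in (mons_le N)" using in_supp_mons_le by blast
  then have "f = (\<Sum>i\<le>N. hom_comp i f)" by (rule sum_hom_comp[symmetric])
  also have "\<dots> \<in> J" by (rule is_ideal_sum) (use assms in auto)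
  finally show ?thesis .
qed

text \<open>Let \<open>p\<close> and \<open>q\<close> be the lowest degrees in which
  \<open>f\<close> and \<open>g\<close> have components outside \<open>J\<close>. Modulo
  \<open>J\<close>, the component of \<open>f * g\<close> in degree \<open>p + q\<close> is the
  product of these two components.\<close>

lemma homogeneous_prime:
  fixes J :: "('v::finite, 'k::field) mpoly set"
  assumes J: "is_homogeneous_ideal J" "J \<noteq> UNIV"
    and prime: "\<And>i j a b. a \<in> hom_part i \<Longrightarrow> b \<in> hom_part j \<Longrightarrow> a * b \<in> J \<Longrightarrow> a \<in> J \<or> b \<in> J"
  shows "is_prime_ideal J"
  unfolding is_prime_ideal_def
proof (intro conjI allI impI)
  show ideal: "is_ideal J" using J(1) by (simp add: is_homogeneous_ideal_def)
  show "J \<noteq> UNIV" by fact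
  fix f g assume fg: "f * g \<in> J"
  show "f \<in> J \<or> g \<in> J"
  proof (rule ccontr)
    assume "\<not> ?thesis"
    then have ex: "\<exists>i. hom_comp i f \<notin> J" "\<exists>i. hom_comp i g \<notin> J" using hom_ideal_memI[OF ideal] by blast+
    define p where "p = (LEAST i. hom_comp i f \<notin> J)"
    define q where "q = (LEAST i. hom_comp i g \<notin> J)"
    have p: "hom_comp p f \<notin> J" "\<And>i. i < p \<Longrightarrow> hom_comp i f \<in> J"
      unfolding p_def using LeastI_ex[OF ex(1)] not_less_Least by blast+
    have q: "hom_comp q g \<notin> J" "\<And>i. i < q \<Longrightarrow> hom_comp i g \<in> J"
      unfolding q_def using LeastI_ex[OF ex(2)] not_less_Least by blast+
    let ?t = "\<lambda>i. hom_comp i f * hom_comp (p + q - i) g"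
    have "hom_comp (p + q) (f * g) = ?t p + (\<Sum>i\<in>{..p+q} - {p}. ?t i)"
      unfolding hom_comp_mult by (rule sum.remove) auto
    moreover have "hom_comp (p + q) (f * g) \<in> J" using J(1) fg by (simp add: is_homogeneous_ideal_def)
    moreover have "(\<Sum>i\<in>{..p+q} - {p}. ?t i) \<in> J"
    proof (rule is_ideal_sum[OF ideal])
      fix i assume "i \<in> {..p+q} - {p}"
      then consider "i < p" | "p + q - i < q" by fastforce
      then show "?t i \<in> J"
      proof cases
        case 1
        then show ?thesis using is_ideal_mult[OF ideal p(2)] by (subst mult.commute) blast
      next
        case 2
        then show ?thesis using is_ideal_mult[OF ideal q(2)] by simp
      qed
    qed
    ultimately have "?t p + (\<Sum>i\<in>{..p+q} - {p}. ?t i) - (\<Sum>i\<in>{..p+q} - {p}. ?t i) \<in> J"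
      by (intro mpoly.subspace_diff[OF subspace_ideal[OF ideal]]) simp_all
    then have "?t p \<in> J" by simp
    then show False using prime[of "hom_comp p f" p "hom_comp q g" q] p(1) q(1) by simp
  qed
qed

section \<open>The ideals \<open>J + (a)\<close> and \<open>J : a\<close>\<close>

definition adjoin :: "('v::finite, 'k::field) mpoly set \<Rightarrow> ('v, 'k) mpoly \<Rightarrow> ('v, 'k) mpoly set" where
  "adjoin J a = {g + r * a | g r. g \<in> J}"

definition colon :: "('v::finite, 'k::field) mpoly set \<Rightarrow> ('v, 'k) mpoly \<Rightarrow> ('v, 'k) mpoly set" where
  "colon J a = {f. f * a \<in> J}"

context
  fixes J :: "('v::finite, 'k::field) mpoly set" and a :: "('v, 'k) mpoly" and e :: nat
  assumes J: "is_homogeneous_ideal J" and a: "a \<in> hom_part e"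
begin

private lemma ideal_J: "is_ideal J"
  using J by (simp add: is_homogeneous_ideal_def)

lemma adjoin_superset: "J \<subseteq> adjoin J a"
proof
  fix g assume "g \<in> J"
  moreover have "g = g + 0 * a" by simp
  ultimately show "g \<in> adjoin J a" unfolding adjoin_def by blast
qed

lemma adjoin_self: "a \<in> adjoin J a"
proof -
  have "a = 0 + 1 * a" by simp
  then show ?thesis unfolding adjoin_def using is_ideal_0[OF ideal_J] by blast
qed

lemma colon_superset: "J \<subseteq> colon J a"
  unfolding colon_def using is_ideal_mult[OF ideal_J] by (auto simp: mult.commute)

lemma homogeneous_adjoin: "is_homogeneous_ideal (adjoin J a)"
proof -
  have ideal: "is_ideal (adjoin J a)"
    unfolding is_ideal_def
  proof (intro conjI ballI allI)
    show "0 \<in> adjoin J a" using adjoin_superset is_ideal_0[OF ideal_J] by blast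
    fix x y r assume "x \<in> adjoin J a"
    then obtain g s where x: "x = g + s * a" "g \<in> J" by (auto simp: adjoin_def)
    have "r * x = r * g + (r * s) * a" by (simp add: x algebra_simps)
    then show "r * x \<in> adjoin J a" unfolding adjoin_def using is_ideal_mult[OF ideal_J x(2)] by blast
    assume "y \<in> adjoin J a"
    then obtain g' s' where y: "y = g' + s' * a" "g' \<in> J" by (auto simp: adjoin_def)
    have "x + y = (g + g') + (s + s') * a" by (simp add: x y algebra_simps)
    then show "x + y \<in> adjoin J a" unfolding adjoin_def using is_ideal_add[OF ideal_J x(2) y(2)] by blast
  qed
  have "hom_comp j x \<in> adjoin J a" if x: "x \<in> adjoin J a" for x j
  proof -
    obtain g s where x: "x = g + s * a" "g \<in> J" using x by (auto simp: adjoin_def)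
    have "hom_comp j x = hom_comp j g + (if e \<le> j then hom_comp (j - e) s else 0) * a"
      by (simp add: x hom_comp_add hom_comp_mult_hom_part[OF a])
    moreover have "hom_comp j g \<in> J" using J x(2) by (simp add: is_homogeneous_ideal_def)
    ultimately show ?thesis unfolding adjoin_def by blast
  qed
  then show ?thesis using ideal by (simp add: is_homogeneous_ideal_def)
qed

lemma homogeneous_colon: "is_homogeneous_ideal (colon J a)"
proof -
  have "hom_comp j f * a \<in> J" if "f * a \<in> J" for f j
  proof -
    have "hom_comp (j + e) (f * a) \<in> J" using J that by (simp add: is_homogeneous_ideal_def)
    then show ?thesis by (simp add: hom_comp_mult_hom_part[OF a])
  qed
  then show ?thesis
    using ideal_J by (simp add: is_homogeneous_ideal_def is_ideal_def colon_def distrib_right mult.assoc)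
qed

text \<open>One half of the count given by the exact sequence that relates the quotients by
  \<open>J : a\<close> (shifted by \<open>e\<close>), \<open>J\<close> and \<open>J + (a)\<close>.
  In degree \<open>m\<close>, the ideal \<open>J + (a)\<close> is spanned by a basis of the part of
  \<open>J\<close> together with the multiples of \<open>a\<close> by the standard monomials of
  \<open>J : a\<close> of degree \<open>m - e\<close>.\<close>

lemma hilbert_fun_adjoin_colon:
  "hilbert_fun J m \<le> hilbert_fun (adjoin J a) m + (if e \<le> m then hilbert_fun (colon J a) (m - e) else 0)"
proof -
  let ?A = "mons_eq m :: ('v \<Rightarrow>\<^sub>0 nat) set"
  let ?K = "adjoin J a" and ?L = "colon J a"
  have ideal_K: "is_ideal ?K" and ideal_L: "is_ideal ?L"
    using homogeneous_adjoin homogeneous_colon by (simp_all add: is_homogeneous_ideal_def)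
  define T where "T = (if e \<le> m then std_mons ?L (mons_eq (m - e)) else {})"
  have finT: "finite T"
    unfolding T_def using finite_subset[OF std_mons_subset[of ?L] finite_mons_eq[of "m - e"]] by simp
  obtain B where B: "B \<subseteq> J \<inter> supp_in ?A" "mpoly.independent B" "J \<inter> supp_in ?A \<subseteq> mpoly.span B"
    "card B = mpoly.dim (J \<inter> supp_in ?A)" using mpoly.basis_exists by blast
  have finB: "finite B" by (rule finite_independent_supp_in[OF finite_mons_eq B(2)]) (use B(1) in blast)
  let ?S = "B \<union> (\<lambda>\<alpha>. Poly_Mapping.single \<alpha> 1 * a) ` T"
  have "?K \<inter> supp_in ?A \<subseteq> mpoly.span ?S"
  proof
    fix f assume f: "f \<in> ?K \<inter> supp_in ?A"
    then obtain g r where fgr: "f = g + r * a" "g \<in> J" by (auto simp: adjoin_def)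
    \<comment> \<open>As \<open>f\<close> and \<open>a\<close> are homogeneous, only the component
      of the cofactor in degree \<open>m - e\<close> matters.\<close>
    define r' where "r' = (if e \<le> m then hom_comp (m - e) r else 0)"
    have "f = hom_comp m f" using f by (simp add: hom_comp_hom_part[of f m] hom_part_eq)
    then have f_eq: "f = hom_comp m g + r' * a"
      by (simp add: fgr(1) hom_comp_add hom_comp_mult_hom_part[OF a] r'_def)
    \<comment> \<open>The cofactor is reduced modulo \<open>J : a\<close>, whose multiples of
      \<open>a\<close> lie in \<open>J\<close>.\<close>
    have "\<exists>w\<in>supp_in T. (r' - w) * a \<in> J"
    proof (cases "e \<le> m")
      case True
      then have "r' \<in> supp_in (mons_eq (m - e))" by (simp add: r'_def flip: hom_part_eq)
      then show ?thesis using std_mons_reduction[OF finite_mons_eq subspace_ideal[OF ideal_L], of r' "m - e"] True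
        by (auto simp: T_def colon_def)
    next
      case False
      then show ?thesis using is_ideal_0[OF ideal_J] by (intro bexI[of _ 0]) (simp_all add: r'_def supp_in_def)
    qed
    then obtain w where w: "w \<in> supp_in T" "(r' - w) * a \<in> J" by blast
    have "mpoly.subspace {w. w * a \<in> mpoly.span ?S}"
      by (rule mpoly.subspaceI)
        (auto simp: distrib_right mscale_mult intro: mpoly.span_add mpoly.span_zero mpoly.span_scale)
    moreover have "(\<lambda>\<alpha>. Poly_Mapping.single \<alpha> 1) ` T \<subseteq> {w. w * a \<in> mpoly.span ?S}"
      by (auto intro!: mpoly.span_base)
    ultimately have "mpoly.span ((\<lambda>\<alpha>. Poly_Mapping.single \<alpha> 1) ` T) \<subseteq> {w. w * a \<in> mpoly.span ?S}"
      by (rule mpoly.span_minimal[rotated])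
    then have wa: "w * a \<in> mpoly.span ?S" using w(1) span_monomials[OF finT] by blast
    have deg: "w * a \<in> supp_in ?A"
    proof (cases "e \<le> m")
      case True
      then have "w \<in> hom_part (m - e)" using w(1) std_mons_subset by (fastforce simp: T_def hom_part_eq supp_in_def)
      then show ?thesis using hom_part_mult[OF _ a, of w "m - e"] True by (simp add: hom_part_eq)
    next
      case False
      then show ?thesis using w(1) by (simp add: T_def supp_in_def keys_eq_empty)
    qed
    have "f - w * a = hom_comp m g + (r' - w) * a" by (simp add: f_eq left_diff_distrib)
    also have "\<dots> \<in> J" using J fgr(2) w(2) by (intro is_ideal_add[OF ideal_J]) (auto simp: is_homogeneous_ideal_def)
    finally have "f - w * a \<in> J \<inter> supp_in ?A"
      using f deg mpoly.subspace_diff[OF subspace_supp_in] by blast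
    then have "f - w * a \<in> mpoly.span ?S" using B(3) mpoly.span_mono[of B ?S] by blast
    then have "(f - w * a) + w * a \<in> mpoly.span ?S" using wa by (rule mpoly.span_add)
    then show "f \<in> mpoly.span ?S" by simp
  qed
  then have "mpoly.dim (?K \<inter> supp_in ?A) \<le> card ?S" using finB finT by (intro mpoly.dim_le_card) auto
  also have "\<dots> \<le> card B + card T"
    using card_Un_le[of B] card_image_le[OF finT] by (meson add_left_mono order_trans)
  finally have "card ?A - card (std_mons ?K ?A) \<le> card ?A - card (std_mons J ?A) + card T"
    unfolding B(4) dim_supp_in_Int[OF finite_mons_eq subspace_ideal[OF ideal_K]]
      dim_supp_in_Int[OF finite_mons_eq subspace_ideal[OF ideal_J]] .
  moreover have "card (std_mons ?K ?A) \<le> card ?A" "card (std_mons J ?A) \<le> card ?A"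
    by (rule card_mono[OF finite_mons_eq std_mons_subset])+
  ultimately have "card (std_mons J ?A) \<le> card (std_mons ?K ?A) + card T" by linarith
  then show ?thesis
    by (simp add: hilbert_fun_eq[OF ideal_J] hilbert_fun_eq[OF ideal_K] hilbert_fun_eq[OF ideal_L] T_def split: if_splits)
qed

end

subsection \<open>Growth and chains of primes\<close>

text \<open>Cumulative sums are monotone in \<open>m\<close> and absorb the degree shift by
  \<open>e\<close>, see \<open>sum_shift_le\<close>.\<close>

definition hilbert_sum :: "('v::finite, 'k::field) mpoly set \<Rightarrow> nat \<Rightarrow> nat" where
  "hilbert_sum J m = (\<Sum>j\<le>m. hilbert_fun J j)"

text \<open>With the factor \<open>m + 1\<close> on the left instead of an exponent \<open>c - 1\<close> on the right, the case \<open>c = 0\<close>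
  is meaningful: it forces the sums to vanish.\<close>

definition slow_growth :: "nat \<Rightarrow> ('v::finite, 'k::field) mpoly set \<Rightarrow> bool" where
  "slow_growth c J \<longleftrightarrow> (\<exists>C. \<forall>m. (m + 1) * hilbert_sum J m \<le> C * (m + 1) ^ c)"

lemma hom_ideal_is_ideal: "is_homogeneous_ideal J \<Longrightarrow> is_ideal J"
  by (simp add: is_homogeneous_ideal_def)

lemma is_ideal_UNIV: "is_ideal UNIV"
  by (simp add: is_ideal_def)

lemma slow_growth_UNIV: "slow_growth c (UNIV :: ('v::finite, 'k::field) mpoly set)"
  by (simp add: slow_growth_def hilbert_sum_def hilbert_fun_eq[OF is_ideal_UNIV])

text \<open>This transfers \<open>wf_downsets\<close> to homogeneous ideals and thus provides
  maximal elements in families of them.\<close>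

lemma std_set_strict_antimono:
  fixes J J' :: "('v::finite, 'k::field) mpoly set"
  assumes J: "is_homogeneous_ideal J" and J': "is_homogeneous_ideal J'" and sub: "J \<subset> J'"
  shows "std_set J' \<subset> std_set J"
proof (rule psubsetI)
  have mono: "std_mons J' A \<subseteq> std_mons J A" for A using sub by (intro std_mons_antimono) blast
  then show "std_set J' \<subseteq> std_set J" unfolding std_set_def by blast
  show "std_set J' \<noteq> std_set J"
  proof
    assume "std_set J' = std_set J"
    then have "lookup ` std_mons J (mons_eq m) = lookup ` std_mons J' (mons_eq m)" for m
      using level_std_set[of m J] level_std_set[of m J'] by simp
    then have eq: "std_mons J (mons_eq m) = std_mons J' (mons_eq m)" for m
      using inj_on_image_eq_iff[OF inj_lookup[of UNIV]] by blast
    have hom: "J' \<inter> supp_in (mons_eq m) \<subseteq> J" for m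
      by (rule subspace_eqI_std_mons)
        (use sub eq J J' in \<open>auto intro: subspace_ideal hom_ideal_is_ideal\<close>)
    have "J' \<subseteq> J"
    proof
      fix f assume "f \<in> J'"
      then have "hom_comp j f \<in> J' \<inter> supp_in (mons_eq j)" for j
        using J' by (simp add: is_homogeneous_ideal_def flip: hom_part_eq)
      then show "f \<in> J" using hom hom_ideal_memI[OF hom_ideal_is_ideal[OF J]] by blast
    qed
    then show False using sub by blast
  qed
qed

lemma sum_shift_le:
  fixes g :: "nat \<Rightarrow> nat"
  shows "(\<Sum>j\<le>m. if i \<le> j then g (j - i) else 0) \<le> (\<Sum>j\<le>m. g j)"
proof -
  have "(\<Sum>j\<le>m. if i \<le> j then g (j - i) else 0) = (\<Sum>j\<in>{i..m}. g (j - i))"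
    by (rule sum.mono_neutral_cong_right) auto
  also have "\<dots> = (\<Sum>j\<in>(\<lambda>j. j - i) ` {i..m}. g j)"
    by (subst sum.reindex) (auto intro!: inj_onI)
  also have "\<dots> \<le> (\<Sum>j\<le>m. g j)" by (rule sum_mono2) auto
  finally show ?thesis .
qed

text \<open>Take \<open>J\<close> maximal among the homogeneous ideals above \<open>I\<close> with
  fast growth. If \<open>a * b\<close> lies in \<open>J\<close> but neither factor does, then
  \<open>J + (a)\<close> and \<open>J : a\<close> are strictly larger, hence of slow growth, and
  adding their Hilbert functions makes the growth of \<open>J\<close> slow.\<close>

lemma prime_with_growth:
  fixes I :: "('v::finite, 'k::field) mpoly set"
  assumes I: "is_homogeneous_ideal I" "\<not> slow_growth c I"
  obtains P where "is_homogeneous_ideal P" "is_prime_ideal P" "I \<subseteq> P" "\<not> slow_growth c P"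
proof -
  let ?S = "{J. is_homogeneous_ideal J \<and> I \<subseteq> J \<and> \<not> slow_growth c J}"
  \<comment> \<open>A minimal set of standard monomials belongs to a maximal ideal.\<close>
  obtain X where X: "X \<in> std_set ` ?S"
      "\<And>Y. (Y, X) \<in> {(X, Y). downset X \<and> downset Y \<and> X \<subset> Y} \<Longrightarrow> Y \<notin> std_set ` ?S"
    by (rule wfE_min[OF wf_downsets, of "std_set I" "std_set ` ?S"]) (use I in auto)
  then obtain J where J: "is_homogeneous_ideal J" "I \<subseteq> J" "\<not> slow_growth c J" "X = std_set J" by blast
  have ideal_J: "is_ideal J" by (rule hom_ideal_is_ideal[OF J(1)])
  have max: "slow_growth c J'" if J': "is_homogeneous_ideal J'" "J \<subset> J'" for J'
  proof (rule ccontr)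
    assume "\<not> slow_growth c J'"
    then have "std_set J' \<in> std_set ` ?S" using J(2) J' by blast
    moreover have "(std_set J', X) \<in> {(X, Y). downset X \<and> downset Y \<and> X \<subset> Y}"
      using std_set_strict_antimono[OF J(1) J'] J(4) downset_std_set[OF ideal_J]
        downset_std_set[OF hom_ideal_is_ideal[OF J'(1)]] by simp
    ultimately show False using X(2) by blast
  qed
  have "is_prime_ideal J"
  proof (rule homogeneous_prime[OF J(1)])
    show "J \<noteq> UNIV" using J(3) slow_growth_UNIV by blast
    fix i j a b assume a: "a \<in> hom_part i" and ab: "a * b \<in> J"
    show "a \<in> J \<or> b \<in> J"
    proof (rule ccontr)
      assume "\<not> ?thesis"
      then have "a \<notin> J" "b \<notin> J" by simp_all
      have "J \<subset> adjoin J a" using adjoin_superset[OF J(1) a] adjoin_self[OF J(1) a] \<open>a \<notin> J\<close> by blast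
      then obtain C where C: "\<And>m. (m + 1) * hilbert_sum (adjoin J a) m \<le> C * (m + 1) ^ c"
        using max[OF homogeneous_adjoin[OF J(1) a]] unfolding slow_growth_def by blast
      have "b \<in> colon J a" using ab by (simp add: colon_def mult.commute)
      then have "J \<subset> colon J a" using colon_superset[OF J(1) a] \<open>b \<notin> J\<close> by blast
      then obtain C' where C': "\<And>m. (m + 1) * hilbert_sum (colon J a) m \<le> C' * (m + 1) ^ c"
        using max[OF homogeneous_colon[OF J(1) a]] unfolding slow_growth_def by blast
      have "(m + 1) * hilbert_sum J m \<le> (C + C') * (m + 1) ^ c" for m
      proof -
        have "hilbert_sum J m \<le> (\<Sum>j\<le>m. hilbert_fun (adjoin J a) j +
            (if i \<le> j then hilbert_fun (colon J a) (j - i) else 0))"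
          unfolding hilbert_sum_def by (rule sum_mono) (rule hilbert_fun_adjoin_colon[OF J(1) a])
        also have "\<dots> \<le> hilbert_sum (adjoin J a) m + hilbert_sum (colon J a) m"
          unfolding hilbert_sum_def sum.distrib by (rule add_left_mono[OF sum_shift_le])
        finally have "(m + 1) * hilbert_sum J m \<le>
            (m + 1) * (hilbert_sum (adjoin J a) m + hilbert_sum (colon J a) m)" by (rule mult_le_mono2)
        then show ?thesis using C[of m] C'[of m] by (simp only: distrib_left distrib_right)
      qed
      then show False using J(3) unfolding slow_growth_def by blast
    qed
  qed
  then show ?thesis by (rule that[OF J(1) _ J(2,3)])
qed

text \<open>If all variables lay in \<open>P\<close>, the only possible standard monomial would be
  \<open>1\<close>. The cumulative sums would then be at most \<open>1\<close>, which is slow growth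
  of order \<open>Suc c\<close>.\<close>

lemma prime_contains_no_variable:
  fixes P :: "('v::finite, 'k::field) mpoly set"
  assumes "is_ideal P" "\<not> slow_growth (Suc c) P"
  obtains v where "Poly_Mapping.single (Poly_Mapping.single v 1) 1 \<notin> P"
proof (rule ccontr)
  assume "\<not> thesis"
  then have vars: "Poly_Mapping.single (Poly_Mapping.single v 1) 1 \<in> P" for v using that by blast
  have "std_mons P (mons_eq m) \<subseteq> {0}" for m
  proof
    fix \<alpha> assume \<alpha>: "\<alpha> \<in> std_mons P (mons_eq m)"
    show "\<alpha> \<in> {0}"
    proof (rule ccontr)
      assume "\<alpha> \<notin> {0}"
      then obtain v where v: "lookup \<alpha> v \<noteq> 0" by (auto simp: poly_mapping_eq_iff fun_eq_iff)
      have "Poly_Mapping.single v 1 + (\<alpha> - Poly_Mapping.single v 1) = \<alpha>"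
        by (rule poly_mapping_eqI) (use v in \<open>auto simp: lookup_add lookup_minus lookup_single when_def\<close>)
      then have "Poly_Mapping.single \<alpha> (1::'k) =
          Poly_Mapping.single (\<alpha> - Poly_Mapping.single v 1) 1 * Poly_Mapping.single (Poly_Mapping.single v 1) 1"
        by (simp add: mult_single add.commute)
      then have "Poly_Mapping.single \<alpha> (1::'k) \<in> P" using is_ideal_mult[OF assms(1) vars] by simp
      moreover have "is_lead (Poly_Mapping.single \<alpha> (1::'k)) \<alpha>" by (simp add: is_lead_def)
      moreover have "\<alpha> \<in> mons_eq m" using \<alpha> std_mons_subset by blast
      ultimately show False using \<alpha> by (auto simp: std_mons_def)
    qed
  qed
  note sub = this
  have h: "hilbert_fun P m \<le> (if m = 0 then 1 else 0)" for m
  proof (cases "m = 0")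
    case True
    then show ?thesis using card_mono[OF _ sub[of 0]] by (simp add: hilbert_fun_eq[OF assms(1)])
  next
    case False
    have "std_mons P (mons_eq m) = {}"
      using sub[of m] std_mons_subset[of P "mons_eq m"] False by (fastforce simp: mons_eq_def mon_deg_def)
    then show ?thesis by (simp add: hilbert_fun_eq[OF assms(1)])
  qed
  have "hilbert_sum P m \<le> 1" for m
  proof -
    have "hilbert_sum P m \<le> (\<Sum>j\<le>m. if j = 0 then 1 else 0)" unfolding hilbert_sum_def by (rule sum_mono[OF h])
    then show ?thesis by simp
  qed
  then have "hilbert_sum P m \<le> (m + 1) ^ c" for m by (rule order_trans) simp
  then have "(m + 1) * hilbert_sum P m \<le> 1 * (m + 1) ^ Suc c" for m
    unfolding power_Suc mult_1 by (rule mult_le_mono2)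
  then show False using assms(2) unfolding slow_growth_def by blast
qed

text \<open>Primality gives \<open>colon P x = P\<close>, so the Hilbert function of
  \<open>P\<close> grows from degree \<open>m - 1\<close> to \<open>m\<close> by at most that of
  \<open>P + (x)\<close> in degree \<open>m\<close>. Hence it is bounded by the cumulative sums of
  the latter, and summing once more costs one factor \<open>m + 1\<close>.\<close>

lemma growth_adjoin_variable:
  fixes P :: "('v::finite, 'k::field) mpoly set"
  assumes P: "is_homogeneous_ideal P" "is_prime_ideal P" "\<not> slow_growth (Suc c) P"
    and x: "x \<in> hom_part 1" "x \<notin> P"
  shows "\<not> slow_growth c (adjoin P x)"
proof
  assume "slow_growth c (adjoin P x)"
  then obtain C where C: "\<And>m. (m + 1) * hilbert_sum (adjoin P x) m \<le> C * (m + 1) ^ c"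
    unfolding slow_growth_def by blast
  have colon: "colon P x = P"
    using P(2) x(2) is_ideal_mult[OF hom_ideal_is_ideal[OF P(1)]]
    by (auto simp: colon_def is_prime_ideal_def mult.commute)
  have "hilbert_fun P m \<le> hilbert_sum (adjoin P x) m" for m
  proof (induction m)
    case 0
    show ?case using hilbert_fun_adjoin_colon[OF P(1) x(1), of 0] by (simp add: hilbert_sum_def)
  next
    case (Suc m)
    show ?case using hilbert_fun_adjoin_colon[OF P(1) x(1), of "Suc m"] Suc
      by (simp add: hilbert_sum_def colon)
  qed
  moreover have "hilbert_sum (adjoin P x) j \<le> hilbert_sum (adjoin P x) m" if "j \<le> m" for j m
    unfolding hilbert_sum_def by (rule sum_mono2) (use that in auto)
  ultimately have "hilbert_sum P m \<le> (\<Sum>j\<le>m. hilbert_sum (adjoin P x) m)" for m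
    unfolding hilbert_sum_def[of P] by (intro sum_mono) (meson atMost_iff order_trans)
  then have "hilbert_sum P m \<le> (m + 1) * hilbert_sum (adjoin P x) m" for m by simp
  then have "hilbert_sum P m \<le> C * (m + 1) ^ c" for m using C[of m] by (rule order_trans)
  then have "(m + 1) * hilbert_sum P m \<le> C * (m + 1) ^ Suc c" for m
    using mult_le_mono2[of "hilbert_sum P m" "C * (m + 1) ^ c" "m + 1"] by (simp add: mult.left_commute)
  then show False using P(3) unfolding slow_growth_def by blast
qed

section \<open>Long chains of primes from fast growth\<close>

definition prime_chain :: "('v::finite, 'k::field) mpoly set \<Rightarrow> nat \<Rightarrow> (nat \<Rightarrow> ('v, 'k) mpoly set) \<Rightarrow> bool" where
  "prime_chain I r P \<longleftrightarrow> (\<forall>i\<le>r. is_prime_ideal (P i) \<and> I \<subseteq> P i) \<and> (\<forall>i<r. P i \<subset> P (Suc i))"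

text \<open>Pass to a homogeneous prime \<open>P\<close> with the same growth, adjoin a variable
  outside it, which lowers the order by at most one, and put \<open>P\<close> in front of the chain
  found above \<open>P + (x)\<close>.\<close>

lemma prime_chain_of_growth:
  fixes I :: "('v::finite, 'k::field) mpoly set"
  assumes "is_homogeneous_ideal I" "\<not> slow_growth c I"
  shows "\<exists>P. prime_chain I c P"
  using assms
proof (induction c arbitrary: I)
  case 0
  then obtain P where "is_prime_ideal P" "I \<subseteq> P" by (blast elim: prime_with_growth)
  then show ?case by (intro exI[of _ "\<lambda>_. P"]) (simp add: prime_chain_def)
next
  case (Suc c)
  obtain P where P: "is_homogeneous_ideal P" "is_prime_ideal P" "I \<subseteq> P" "\<not> slow_growth (Suc c) P"
    using prime_with_growth[OF Suc.prems] by blast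
  obtain v where v: "Poly_Mapping.single (Poly_Mapping.single v 1) 1 \<notin> P"
    using prime_contains_no_variable[OF hom_ideal_is_ideal[OF P(1)] P(4)] by blast
  define x where "x = Poly_Mapping.single (Poly_Mapping.single v (1::nat)) (1::'k)"
  have "mon_deg (Poly_Mapping.single v (1::nat)) = 1"
    by (simp add: mon_deg_def lookup_single when_def)
  then have x: "x \<in> hom_part 1" "x \<notin> P" using v by (simp_all add: x_def hom_part_def)
  obtain Q where Q: "prime_chain (adjoin P x) c Q"
    using Suc.IH[OF homogeneous_adjoin[OF P(1) x(1)] growth_adjoin_variable[OF P(1,2,4) x]] by blast
  have sub: "P \<subset> adjoin P x" using adjoin_superset[OF P(1) x(1)] adjoin_self[OF P(1) x(1)] x(2) by blast
  have "prime_chain I (Suc c) (case_nat P Q)"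
    unfolding prime_chain_def
  proof (intro conjI allI impI)
    fix i assume "i \<le> Suc c"
    then show "is_prime_ideal (case_nat P Q i)" "I \<subseteq> case_nat P Q i"
      using P Q sub by (auto simp: prime_chain_def split: nat.split)
  next
    fix i assume "i < Suc c"
    then show "case_nat P Q i \<subset> case_nat P Q (Suc i)"
      using Q sub by (cases i) (auto simp: prime_chain_def)
  qed
  then show ?case by blast
qed

text \<open>The right-hand side is the product \<open>(m + 1) * ... * (m + c)\<close>.\<close>

lemma power_le_fact_binomial: "(m + 1) ^ c \<le> fact c * ((m + c) choose c)"
proof (induction c)
  case 0
  show ?case by simp
next
  case (Suc c)
  have "(m + 1) ^ Suc c \<le> (m + 1) * (fact c * ((m + c) choose c))"
    unfolding power_Suc by (rule mult_le_mono2[OF Suc])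
  also have "\<dots> \<le> fact c * (Suc (m + c) * ((m + c) choose c))" by (simp add: algebra_simps)
  also have "\<dots> = fact c * (Suc c * (Suc (m + c) choose Suc c))" by (simp only: Suc_times_binomial)
  also have "\<dots> = fact (Suc c) * ((m + Suc c) choose Suc c)"
    by (simp only: fact_Suc of_nat_id add_Suc_right mult_ac)
  finally show ?case .
qed

text \<open>A cone of dimension \<open>card Z\<close> at the origin has
  \<open>(m + card Z) choose card Z\<close> points of degree at most \<open>m\<close>. This is of
  order \<open>card Z\<close> in \<open>m\<close>, one more than slow growth permits.\<close>

lemma cone_growth:
  fixes I :: "('v::finite, 'k::field) mpoly set"
  assumes I: "is_ideal I" and sub: "cone u Z \<subseteq> std_set I"
  shows "\<not> slow_growth (card Z) I"
proof
  assume "slow_growth (card Z) I"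
  then obtain C where C: "\<And>m. (m + 1) * hilbert_sum I m \<le> C * (m + 1) ^ card Z"
    unfolding slow_growth_def by blast
  \<comment> \<open>The set is down-closed, so the cone may be moved to the origin.\<close>
  have cone0: "cone (\<lambda>_. 0) Z \<subseteq> std_set I"
  proof
    fix f assume f: "f \<in> cone (\<lambda>_. 0) Z"
    define g where "g v = (if v \<in> Z then f v + u v else u v)" for v
    have "g \<in> cone u Z" by (simp add: cone_def g_def)
    moreover have "f \<le> g" using f by (auto simp: cone_def g_def le_fun_def)
    ultimately show "f \<in> std_set I" using sub downset_std_set[OF I] by (auto simp: downset_def)
  qed
  have h: "card (level j (cone (\<lambda>_. 0) Z)) \<le> hilbert_fun I j" for j
    unfolding hilbert_fun_eq_card_level[OF I] by (rule card_mono[OF finite_level level_mono[OF cone0]])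
  have [simp]: "fdeg (\<lambda>_::'v. 0) = 0" by (simp add: fdeg_def)
  have "(m + card Z) choose card Z \<le> hilbert_sum I m" for m
  proof (cases "card Z")
    case 0
    then have "1 \<le> hilbert_fun I 0" using h[of 0] by (simp add: card_level_cone)
    also have "\<dots> \<le> hilbert_sum I m" unfolding hilbert_sum_def by (rule member_le_sum) auto
    finally show ?thesis using 0 by simp
  next
    case (Suc c)
    have "(m + card Z) choose card Z = (\<Sum>j\<le>m. (c + j) choose c)"
      by (simp only: Suc choose_rising_sum(1)) (simp add: add.commute)
    also have "\<dots> \<le> hilbert_sum I m" unfolding hilbert_sum_def
      by (rule sum_mono) (use h in \<open>simp add: card_level_cone_Suc[OF Suc] add.commute\<close>)
    finally show ?thesis .
  qed
  note bin = this
  have "m + 1 \<le> fact (card Z) * C" for m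
  proof -
    have "(m + 1) ^ card Z * (m + 1) \<le> fact (card Z) * ((m + card Z) choose card Z) * (m + 1)"
      by (rule mult_le_mono1[OF power_le_fact_binomial])
    also have "\<dots> \<le> fact (card Z) * hilbert_sum I m * (m + 1)"
      by (intro mult_le_mono1 mult_le_mono2 bin)
    also have "\<dots> = fact (card Z) * ((m + 1) * hilbert_sum I m)" by (simp only: mult_ac)
    also have "\<dots> \<le> fact (card Z) * (C * (m + 1) ^ card Z)" by (rule mult_le_mono2[OF C])
    finally have "(m + 1) ^ card Z * (m + 1) \<le> (m + 1) ^ card Z * (fact (card Z) * C)" by (simp add: ac_simps)
    then show ?thesis by (simp only: mult_le_cancel1) simp
  qed
  from this[of "fact (card Z) * C"] show False by simp
qed

subsection \<open>Finiteness of the Krull dimension\<close>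

text \<open>The primes in a chain need not be homogeneous, so degree at most \<open>m\<close>
  replaces degree equal to \<open>m\<close>.\<close>

definition affine_hilbert :: "('v::finite, 'k::field) mpoly set \<Rightarrow> nat \<Rightarrow> nat" where
  "affine_hilbert J m = card (std_mons J (mons_le m))"

lemma card_independent_le_dim:
  fixes V :: "('v::finite, 'k::field) mpoly set"
  assumes "finite A" "mpoly.independent X" "X \<subseteq> V \<inter> supp_in A"
  shows "card X \<le> mpoly.dim (V \<inter> supp_in A)"
proof -
  obtain B where B: "B \<subseteq> V \<inter> supp_in A" "mpoly.independent B" "V \<inter> supp_in A \<subseteq> mpoly.span B"
    "card B = mpoly.dim (V \<inter> supp_in A)" using mpoly.basis_exists by blast
  have "finite B" by (rule finite_independent_supp_in[OF assms(1) B(2)]) (use B(1) in blast)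
  then show ?thesis using mpoly.independent_span_bound[OF _ assms(2), of B] assms(3) B(3,4) by auto
qed

text \<open>Multiplication by \<open>f\<close> is injective modulo the prime \<open>P\<close> and
  maps into \<open>Q\<close>. A basis of \<open>P\<close> in degrees up to \<open>m + c\<close>,
  together with the multiples of \<open>f\<close> by the standard monomials of \<open>P\<close> of
  degree at most \<open>m\<close>, is therefore independent inside \<open>Q\<close>.\<close>

lemma affine_hilbert_prime_step:
  fixes P Q :: "('v::finite, 'k::field) mpoly set"
  assumes P: "is_prime_ideal P" and Q: "is_ideal Q" and PQ: "P \<subseteq> Q"
    and f: "f \<in> Q" "f \<notin> P" "f \<in> supp_in (mons_le c)"
  shows "affine_hilbert Q (m + c) + affine_hilbert P m \<le> affine_hilbert P (m + c)"
proof -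
  let ?A = "mons_le (m + c) :: ('v \<Rightarrow>\<^sub>0 nat) set"
  let ?T = "std_mons P (mons_le m)"
  let ?g = "\<lambda>\<alpha>. Poly_Mapping.single \<alpha> 1 * f"
  have ideal_P: "is_ideal P" using P by (simp add: is_prime_ideal_def)
  note sub_P = subspace_ideal[OF ideal_P]
  have finT: "finite ?T" by (rule finite_subset[OF std_mons_subset finite_mons_le])
  obtain B where B: "B \<subseteq> P \<inter> supp_in ?A" "mpoly.independent B" "P \<inter> supp_in ?A \<subseteq> mpoly.span B"
    "card B = mpoly.dim (P \<inter> supp_in ?A)" using mpoly.basis_exists by blast
  have finB: "finite B" by (rule finite_independent_supp_in[OF finite_mons_le B(2)]) (use B(1) in blast)
  have "T' \<subseteq> ?T \<longrightarrow> mpoly.independent (B \<union> ?g ` T') \<and> card (B \<union> ?g ` T') = card B + card T'"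
    if "finite T'" for T'
    using that
  proof (induction T')
    case empty
    show ?case using B(2) by simp
  next
    case (insert \<alpha> T')
    show ?case
    proof (intro impI)
      assume T': "insert \<alpha> T' \<subseteq> ?T"
      then have IH: "mpoly.independent (B \<union> ?g ` T')" "card (B \<union> ?g ` T') = card B + card T'"
        using insert.IH by simp_all
      have notin: "?g \<alpha> \<notin> mpoly.span (B \<union> ?g ` T')"
      proof
        \<comment> \<open>A subspace that contains the span and displays its elements modulo
          \<open>P\<close>.\<close>
        let ?U = "{p + w * f | p w. p \<in> P \<and> w \<in> supp_in T'}"
        have "mpoly.subspace ?U"
        proof (rule mpoly.subspaceI)
          have "0 = 0 + 0 * f" by simp
          then show "0 \<in> ?U" using is_ideal_0[OF ideal_P] mpoly.subspace_0[OF subspace_supp_in] by blast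
          fix x y c assume "x \<in> ?U"
          then obtain p w where x: "x = p + w * f" "p \<in> P" "w \<in> supp_in T'" by blast
          have "mscale c x = mscale c p + mscale c w * f" by (simp add: x mscale_eq algebra_simps)
          then show "mscale c x \<in> ?U"
            using mpoly.subspace_scale[OF sub_P x(2)] mpoly.subspace_scale[OF subspace_supp_in x(3)] by blast
          assume "y \<in> ?U"
          then obtain p' w' where y: "y = p' + w' * f" "p' \<in> P" "w' \<in> supp_in T'" by blast
          have "x + y = (p + p') + (w + w') * f" by (simp add: x y algebra_simps)
          then show "x + y \<in> ?U"
            using mpoly.subspace_add[OF sub_P x(2) y(2)] mpoly.subspace_add[OF subspace_supp_in x(3) y(3)]
            by blast
        qed
        moreover have "B \<union> ?g ` T' \<subseteq> ?U"
        proof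
          fix x assume "x \<in> B \<union> ?g ` T'"
          then consider "x \<in> P" | \<beta> where "x = ?g \<beta>" "\<beta> \<in> T'" using B(1) by blast
          then show "x \<in> ?U"
          proof cases
            case 1
            have "x = x + 0 * f" by simp
            then show ?thesis using 1 mpoly.subspace_0[OF subspace_supp_in] by blast
          next
            case 2
            have "x = 0 + ?g \<beta>" by (simp add: 2)
            then show ?thesis using 2(2) is_ideal_0[OF ideal_P] supp_in_single by blast
          qed
        qed
        ultimately have span: "mpoly.span (B \<union> ?g ` T') \<subseteq> ?U" by (rule mpoly.span_minimal[rotated])
        assume "?g \<alpha> \<in> mpoly.span (B \<union> ?g ` T')"
        then obtain p w where pw: "?g \<alpha> = p + w * f" "p \<in> P" "w \<in> supp_in T'" using span by blast
        let ?w = "Poly_Mapping.single \<alpha> 1 - w"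
        have "?w * f = p" using pw(1) by (simp add: left_diff_distrib)
        \<comment> \<open>Primality cancels \<open>f\<close>; a member of \<open>P\<close> supported
          on standard monomials vanishes, which forces \<alpha> into \<open>T'\<close>.\<close>
        then have "?w \<in> P" using P pw(2) f(2) unfolding is_prime_ideal_def by metis
        moreover have "?w \<in> supp_in ?T"
          by (rule mpoly.subspace_diff[OF subspace_supp_in])
            (use T' pw(3) in \<open>auto simp: supp_in_def\<close>)
        ultimately have "?w = 0" by (rule supp_in_std_mons_Int)
        then have "lookup w \<alpha> = 1" by (metis eq_iff_diff_eq_0 lookup_single_eq)
        then have "\<alpha> \<in> T'" using pw(3) by (auto simp: supp_in_def in_keys_iff)
        then show False using insert.hyps by simp
      qed
      have "mpoly.independent (insert (?g \<alpha>) (B \<union> ?g ` T'))"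
        by (rule mpoly.independent_insertI[OF notin IH(1)])
      moreover have "?g \<alpha> \<notin> B \<union> ?g ` T'"
        by (rule contra_subsetD[OF mpoly.span_superset notin])
      ultimately show "mpoly.independent (B \<union> ?g ` insert \<alpha> T') \<and>
          card (B \<union> ?g ` insert \<alpha> T') = card B + card (insert \<alpha> T')"
        using IH(2) insert.hyps finB by simp
    qed
  qed
  from this[OF finT] have ind: "mpoly.independent (B \<union> ?g ` ?T)" "card (B \<union> ?g ` ?T) = card B + card ?T"
    by simp_all
  have "?g \<alpha> \<in> Q \<inter> supp_in ?A" if "\<alpha> \<in> ?T" for \<alpha>
  proof
    show "?g \<alpha> \<in> Q" by (rule is_ideal_mult[OF Q f(1)])
    show "?g \<alpha> \<in> supp_in ?A"
      by (rule supp_in_mult[OF supp_in_single f(3)])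
        (use that std_mons_subset in \<open>auto simp: mons_le_def mon_deg_add intro: add_mono\<close>)
  qed
  then have "B \<union> ?g ` ?T \<subseteq> Q \<inter> supp_in ?A" using B(1) PQ by blast
  then have "card B + card ?T \<le> mpoly.dim (Q \<inter> supp_in ?A)"
    using card_independent_le_dim[OF finite_mons_le ind(1)] ind(2) by simp
  then have "card ?A - card (std_mons P ?A) + card ?T \<le> card ?A - card (std_mons Q ?A)"
    unfolding B(4) dim_supp_in_Int[OF finite_mons_le sub_P]
      dim_supp_in_Int[OF finite_mons_le subspace_ideal[OF Q]] .
  moreover have "card (std_mons P ?A) \<le> card ?A" "card (std_mons Q ?A) \<le> card ?A"
    by (rule card_mono[OF finite_mons_le std_mons_subset])+
  ultimately show ?thesis unfolding affine_hilbert_def by linarith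
qed

lemma affine_hilbert_pos:
  fixes P :: "('v::finite, 'k::field) mpoly set"
  assumes "is_prime_ideal P"
  shows "1 \<le> affine_hilbert P m"
proof (rule ccontr)
  assume "\<not> ?thesis"
  then have "card (std_mons P (mons_le m)) = 0" by (simp add: affine_hilbert_def)
  then have "std_mons P (mons_le m) = {}"
    using finite_subset[OF std_mons_subset[of P] finite_mons_le[of m]] by simp
  then have "(UNIV :: ('v, 'k) mpoly set) \<inter> supp_in (mons_le m) \<subseteq> P"
    using assms by (intro subspace_eqI_std_mons) (auto simp: is_prime_ideal_def subspace_ideal)
  moreover have "1 \<in> (supp_in (mons_le m) :: ('v, 'k) mpoly set)"
    by (simp add: supp_in_def mons_le_def mon_deg_def)
  ultimately have "1 \<in> P" by blast
  then show False using assms is_ideal_eq_UNIV by (auto simp: is_prime_ideal_def)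
qed

text \<open>Let \<open>n\<close> be the number of variables. Along \<open>n + 1\<close> strict
  inclusions the affine Hilbert function of the smallest prime would grow with order
  \<open>n + 1\<close>, but there are at most \<open>(m + 1) ^ n\<close> monomials of degree at most
  \<open>m\<close>.\<close>

lemma prime_chain_length:
  fixes I :: "('v::finite, 'k::field) mpoly set"
  assumes "prime_chain I r P"
  shows "r \<le> card (UNIV :: 'v set)"
proof (rule ccontr)
  define n where "n = card (UNIV :: 'v set)"
  assume "\<not> r \<le> card (UNIV :: 'v set)"
  then have "Suc n \<le> r" by (simp add: n_def)
  then have prime: "is_prime_ideal (P i)" if "i \<le> Suc n" for i using assms that by (auto simp: prime_chain_def)
  have step: "P i \<subset> P (Suc i)" if "i < Suc n" for i
    using assms that \<open>Suc n \<le> r\<close> by (auto simp: prime_chain_def)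
  have "\<forall>i. \<exists>f N. i < Suc n \<longrightarrow> f \<in> P (Suc i) \<and> f \<notin> P i \<and> f \<in> supp_in (mons_le N)"
    using step in_supp_mons_le by blast
  then obtain f N where f: "\<And>i. i < Suc n \<Longrightarrow> f i \<in> P (Suc i) \<and> f i \<notin> P i \<and> f i \<in> supp_in (mons_le (N i))"
    by metis
  \<comment> \<open>A common degree bound for the elements separating consecutive primes;
    \<open>Suc\<close> makes it positive, as needed for
    \<open>c * j + 1 \<le> c * (j + 1)\<close>.\<close>
  define c where "c = Suc (\<Sum>i<Suc n. N i)"
  have fc: "f i \<in> supp_in (mons_le c)" if "i < Suc n" for i
  proof (rule supp_in_mons_le_mono)
    have "N i \<le> (\<Sum>i<Suc n. N i)" by (rule member_le_sum) (use that in auto)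
    then show "N i \<le> c" by (simp add: c_def)
  qed (use f that in blast)
  \<comment> \<open>The double induction follows Pascal's rule: \<open>i\<close> counts the
    inclusions above the prime, and \<open>j\<close> measures degree in units of
    \<open>c\<close>.\<close>
  have lower: "i \<le> Suc n \<Longrightarrow> (j + i) choose i \<le> affine_hilbert (P (Suc n - i)) (c * j)" for i j
  proof (induction i arbitrary: j)
    case 0
    show ?case using affine_hilbert_pos[OF prime[of "Suc n"]] by simp
  next
    case (Suc i)
    let ?p = "Suc n - Suc i"
    have IH: "(j + i) choose i \<le> affine_hilbert (P (Suc n - i)) (c * j)" for j
      using Suc.IH Suc.prems by simp
    have p: "?p < Suc n" "Suc ?p = Suc n - i" using Suc.prems by simp_all
    show ?case
    proof (induction j)
      case 0
      show ?case using affine_hilbert_pos[OF prime[of ?p]] by simp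
    next
      case (Suc j)
      have "(Suc j + Suc i) choose Suc i = ((Suc j + i) choose i) + ((j + Suc i) choose Suc i)" by simp
      also have "\<dots> \<le> affine_hilbert (P (Suc n - i)) (c * Suc j) + affine_hilbert (P ?p) (c * j)"
        by (rule add_mono[OF IH Suc.IH])
      also have "\<dots> = affine_hilbert (P (Suc ?p)) (c * j + c) + affine_hilbert (P ?p) (c * j)"
        by (simp only: p(2)) (simp add: add.commute)
      also have "\<dots> \<le> affine_hilbert (P ?p) (c * j + c)"
        using f[OF p(1)] fc[OF p(1)] prime[of ?p] prime[of "Suc ?p"] step[OF p(1)] p
        by (intro affine_hilbert_prime_step[where f = "f ?p"]) (auto simp: is_prime_ideal_def)
      finally show ?case by (simp add: add.commute)
    qed
  qed
  have "j + 1 \<le> fact (Suc n) * c ^ n" for j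
  proof -
    have "affine_hilbert (P 0) (c * j) \<le> card (mons_le (c * j) :: ('v \<Rightarrow>\<^sub>0 nat) set)"
      unfolding affine_hilbert_def by (rule card_mono[OF finite_mons_le std_mons_subset])
    also have "\<dots> \<le> (c * j + 1) ^ n" unfolding n_def by (rule card_mons_le)
    also have "\<dots> \<le> (c * (j + 1)) ^ n" by (rule power_mono) (simp_all add: c_def)
    finally have upper: "affine_hilbert (P 0) (c * j) \<le> c ^ n * (j + 1) ^ n"
      by (simp only: power_mult_distrib)
    have "(j + 1) ^ Suc n \<le> fact (Suc n) * ((j + Suc n) choose Suc n)" by (rule power_le_fact_binomial)
    also have "(j + Suc n) choose Suc n \<le> c ^ n * (j + 1) ^ n"
      using lower[of "Suc n" j] upper by simp
    finally have "(j + 1) ^ n * (j + 1) \<le> (j + 1) ^ n * (fact (Suc n) * c ^ n)"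
      by (simp only: power_Suc mult_ac) simp
    then show ?thesis by (simp only: mult_le_cancel1) simp
  qed
  from this[of "fact (Suc n) * c ^ n"] show False by simp
qed

lemma krull_dim_quot_eq: "krull_dim_quot I = Sup {enat r | r. \<exists>P. prime_chain I r P}"
  by (simp add: krull_dim_quot_def prime_chain_def)

text \<open>\<open>proj_dim\<close> applies \<open>the_enat\<close> to a supremum, so that supremum
  must first be known to be finite; \<open>prime_chain_length\<close> supplies this.\<close>

lemma prime_chain_le_proj_dim:
  fixes I :: "('v::finite, 'k::field) mpoly set"
  assumes "proj_dim I = int d" "prime_chain I r P"
  shows "r \<le> Suc d"
proof -
  let ?S = "{enat r | r. \<exists>P. prime_chain I r P}"
  have "krull_dim_quot I \<le> enat (card (UNIV :: 'v set))"
    unfolding krull_dim_quot_eq by (rule Sup_least) (use prime_chain_length in auto)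
  then obtain k where k: "krull_dim_quot I = enat k" by (cases "krull_dim_quot I") auto
  then have "k = Suc d" using assms(1) by (simp add: proj_dim_def)
  moreover have "enat r \<le> krull_dim_quot I"
    unfolding krull_dim_quot_eq by (rule Sup_upper) (use assms(2) in blast)
  ultimately show ?thesis using k by simp
qed

section \<open>Conclusion: the Hilbert polynomial and the bound\<close>

text \<open>Supplies the uniqueness behind the definite description in
  \<open>hilbert_poly\<close>.\<close>

lemma poly_eqI_eventually:
  fixes p q :: "real poly"
  assumes "\<forall>\<^sub>F m in sequentially. poly p (real m) = poly q (real m)"
  shows "p = q"
proof (rule ccontr)
  assume "p \<noteq> q"
  obtain N where N: "\<And>m. m \<ge> N \<Longrightarrow> poly p (real m) = poly q (real m)"
    using assms by (auto simp: eventually_sequentially)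
  have "finite {x. poly (p - q) x = 0}" using \<open>p \<noteq> q\<close> by (intro poly_roots_finite) simp
  moreover have "real ` {N..} \<subseteq> {x. poly (p - q) x = 0}" using N by auto
  ultimately have "finite (real ` {N..})" by (rule rev_finite_subset)
  then have "finite {N..}" by (rule finite_imageD) (simp add: inj_on_def)
  then show False using infinite_Ici by blast
qed

theorem theorem2p3:
  fixes I :: "('v::finite, 'k::field) mpoly set" and d :: nat
  assumes "is_homogeneous_ideal I"
    and "proj_dim I = int d"
  shows "\<forall>m::nat. m \<ge> 1 \<longrightarrow>
    real (hilbert_fun I m) \<ge>
      binom (real m + real d + 1) (d + 1) - binom (real m - ideal_deg I + real d + 1) (d + 1)"
proof (intro allI impI)
  fix m :: nat
  have ideal: "is_ideal I" using assms(1) by (rule hom_ideal_is_ideal)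
  note down = downset_std_set[OF ideal]
  obtain C where C: "finite C" "std_set I = (\<Union>(u,Z)\<in>C. cone u Z)" "disjoint_family_on (\<lambda>(u,Z). cone u Z) C"
    by (rule cone_decomposition[OF down])
  \<comment> \<open>A cone forces growth, growth forces a chain of \<open>card Z\<close> inclusions,
    and the dimension bounds chains by \<open>d + 1\<close>.\<close>
  have dim: "card Z \<le> Suc d" if "(u,Z) \<in> C" for u Z
  proof -
    have "cone u Z \<subseteq> std_set I" using C(2) that by auto
    then have "\<exists>P. prime_chain I (card Z) P"
      using prime_chain_of_growth[OF assms(1)] cone_growth[OF ideal] by blast
    then show ?thesis using prime_chain_le_proj_dim[OF assms(2)] by blast
  qed
  obtain p where p: "\<forall>\<^sub>F m in sequentially. real (card (level m (std_set I))) = poly p (real m)"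
    and coeff: "fact d * coeff p d = real (card {(u,Z)\<in>C. card Z = Suc d})"
    
    using downset_hilbert_poly[OF C, of d] dim by blast
  have h: "real (hilbert_fun I m) = real (card (level m (std_set I)))" for m
    by (simp add: hilbert_fun_eq_card_level[OF ideal])
  have "hilbert_poly I = p"
    unfolding hilbert_poly_def
  proof (rule the_equality)
    show "\<forall>\<^sub>F m in sequentially. real (hilbert_fun I m) = poly p (real m)" using p by (simp add: h)
    fix q assume "\<forall>\<^sub>F m in sequentially. real (hilbert_fun I m) = poly q (real m)"
    then have "\<forall>\<^sub>F m in sequentially. poly q (real m) = poly p (real m)"
      using p by eventually_elim (simp add: h)
    then show "q = p" by (rule poly_eqI_eventually)
  qed
  then have deg: "ideal_deg I = real (card {(u,Z)\<in>C. card Z = Suc d})"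
    using coeff by (simp add: ideal_deg_def assms(2))
  \<comment> \<open>The degree is the number of top-dimensional cones, so the difference of
    binomials is exactly the packing bound.\<close>
  show "real (hilbert_fun I m) \<ge>
      binom (real m + real d + 1) (d + 1) - binom (real m - ideal_deg I + real d + 1) (d + 1)"
    unfolding deg binom_diff_eq_sum h of_nat_le_iff by (rule card_level_downset_ge[OF down C])
qed

end
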